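(* Let $F=(P,Q)$ be any Pinchuk map and let $k$ be $\mathbb{R}$ or any subfield of $\mathbb{R}$ containing the coefficients of $F$ (i.e. the coefficients of the polynomials $P$ and $Q$). Although $F$ is generically two to one as a polynomial map of $\mathbb{R}^2$ to $\mathbb{R}^2$, the degree of the associated extension of function fields $k(P,Q)\subset k(x,y)$ is $6$. Furthermore, this extension has no automorphisms other than the identity: the only field automorphism of $k(x,y)$ fixing every element of $k(P,Q)$ is the identity.
   Context: Pinchuk maps. In $\mathbb{R}[x,y]$ put $t=xy-1$, $h=t(xt+1)$, $f=(xt+1)^2(t^2+y)$, $P=f+h$, $q=-t^2-6th(h+1)$. A Pinchuk map is a polynomial map $F=(P,Q):\mathbb{R}^2\to\mathbb{R}^2$ with this $P$ and with $Q=q-u(f,h)$, where $u$ is a polynomial in two variables with real coefficients chosen so that the Jacobian determinant of $F$ with respect to $(x,y)$ is $j(P,Q)=t^2+(t+f(13+15h))^2+f^2$. "Generically two to one" means that there is a proper Zariski closed subset of the target $\mathbb{R}^2$ such that every point outside it has exactly two inverse images in $\mathbb{R}^2$ under $F$. *)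

theory Defs
  imports
    "HOL-Computational_Algebra.Computational_Algebra"
    "HOL-Algebra.Algebra"
    "HOL-Algebra.Algebraic_Closure_Type"
begin

text \<open>
  The ring \<open>\<real>[x, y]\<close> is \<^typ>\<open>real poly poly\<close>, with \<open>y\<close> as the outer and \<open>x\<close> as the inner
  variable; \<open>\<real>(x, y)\<close> is its field of fractions.
\<close>

definition const2 :: "real \<Rightarrow> real poly poly"
  where "const2 c = [:[:c:]:]"

definition varX :: "real poly poly"
  where "varX = [:[:0, 1:]:]"

definition varY :: "real poly poly"
  where "varY = [:0, 1:]"

definition eval2 :: "real poly poly \<Rightarrow> real \<times> real \<Rightarrow> real"
  where "eval2 p w = poly (poly p [:snd w:]) (fst w)"

text \<open>The substitution \<open>u(a, b)\<close>: \<open>a\<close> replaces \<open>x\<close> and \<open>b\<close> replaces \<open>y\<close>.\<close>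

definition subst2 :: "real poly poly \<Rightarrow> real poly poly \<Rightarrow> real poly poly \<Rightarrow> real poly poly"
  where "subst2 u a b = poly (map_poly (\<lambda>c. poly (map_poly const2 c) a) u) b"

definition partialX :: "real poly poly \<Rightarrow> real poly poly"
  where "partialX p = map_poly pderiv p"

definition partialY :: "real poly poly \<Rightarrow> real poly poly"
  where "partialY p = pderiv p"

definition jacobian :: "real poly poly \<Rightarrow> real poly poly \<Rightarrow> real poly poly"
  where "jacobian p q = partialX p * partialY q - partialY p * partialX q"

definition pinchuk_t :: "real poly poly"
  where "pinchuk_t = varX * varY - 1"

definition pinchuk_h :: "real poly poly"
  where "pinchuk_h = pinchuk_t * (varX * pinchuk_t + 1)"

definition pinchuk_f :: "real poly poly"
  where "pinchuk_f = (varX * pinchuk_t + 1)^2 * (pinchuk_t^2 + varY)"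

definition pinchuk_q :: "real poly poly"
  where "pinchuk_q = - (pinchuk_t^2) - 6 * pinchuk_t * pinchuk_h * (pinchuk_h + 1)"

definition pinchuk_map :: "real poly poly \<Rightarrow> real poly poly \<Rightarrow> bool"
  where "pinchuk_map P Q \<longleftrightarrow>
    P = pinchuk_f + pinchuk_h \<and>
    (\<exists>u. Q = pinchuk_q - subst2 u pinchuk_f pinchuk_h) \<and>
    jacobian P Q =
      pinchuk_t^2 + (pinchuk_t + pinchuk_f * (13 + 15 * pinchuk_h))^2 + pinchuk_f^2"

definition polynomial_map :: "real poly poly \<Rightarrow> real poly poly \<Rightarrow> real \<times> real \<Rightarrow> real \<times> real"
  where "polynomial_map P Q w = (eval2 P w, eval2 Q w)"

definition zariski_closed :: "(real \<times> real) set \<Rightarrow> bool"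
  where "zariski_closed Z \<longleftrightarrow> (\<exists>S. Z = {w. \<forall>g\<in>S. eval2 g w = 0})"

text \<open>\<open>card A = 2\<close> implies that \<open>A\<close> is finite.\<close>

definition generically_two_to_one :: "(real \<times> real \<Rightarrow> real \<times> real) \<Rightarrow> bool"
  where "generically_two_to_one F \<longleftrightarrow>
    (\<exists>Z. zariski_closed Z \<and> Z \<noteq> UNIV \<and> (\<forall>w. w \<notin> Z \<longrightarrow> card {v. F v = w} = 2))"

abbreviation real_field :: "real ring"
  where "real_field \<equiv> ring_of_type_algebra"

abbreviation ratfun_field :: "real poly poly fract ring"
  where "ratfun_field \<equiv> ring_of_type_algebra"

text \<open>
  For a subfield \<open>k\<close> of \<open>\<real>\<close>, the field \<open>k(a, b)\<close> is realised as the subfield of \<open>\<real>(x, y)\<close>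
  generated by \<open>k\<close>, \<open>a\<close> and \<open>b\<close>. In particular, \<open>k(x, y)\<close> is the set of quotients of
  polynomials in \<open>x\<close>, \<open>y\<close> with coefficients in \<open>k\<close>.
\<close>

definition adjoin2 :: "real set \<Rightarrow> real poly poly \<Rightarrow> real poly poly \<Rightarrow> real poly poly fract set"
  where "adjoin2 k a b =
    generate_field ratfun_field (to_fract ` (const2 ` k \<union> {a, b}))"

definition has_coeffs_in :: "real set \<Rightarrow> real poly poly \<Rightarrow> bool"
  where "has_coeffs_in k p \<longleftrightarrow> (\<forall>i j. poly.coeff (poly.coeff p i) j \<in> k)"

definition relative_automorphisms ::
    "('a, 'b) ring_scheme \<Rightarrow> 'a set \<Rightarrow> 'a set \<Rightarrow> ('a \<Rightarrow> 'a) set"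
  where "relative_automorphisms R K E =
    {\<sigma> \<in> ring_iso (R\<lparr>carrier := E\<rparr>) (R\<lparr>carrier := E\<rparr>). \<forall>a\<in>K. \<sigma> a = a}"

end

theory Submission
  imports Defs
begin

text \<open>
  The proof works in the coordinates \<open>f\<close> and \<open>P\<close>. The relation \<open>(h - t) f = h\<^sup>2 (h + 1)\<close>
  together with \<open>h = P - f\<close> expresses \<open>t\<close>, and then \<open>x = (h - t) / t\<^sup>2\<close> and \<open>y = (t + 1) / x\<close>,
  rationally in \<open>f\<close> and \<open>P\<close>, so \<open>k(x, y) = k(P, f)\<close>.

  The Jacobian condition determines \<open>Q\<close> up to a polynomial in \<open>P\<close>: the derivation \<open>j(P, _)\<close> kills
  \<open>P\<close> and maps \<open>f\<close> to \<open>f\<close>, so a polynomial in \<open>f\<close> and \<open>P\<close> that it kills involves \<open>P\<close> alone. Hence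
  \<open>4 Q = V - g(P)\<close> for one explicit polynomial \<open>V\<close> with integer coefficients
  (\<open>pinchuk_map_normal_form\<close>). Setting \<open>x = 0\<close>, where \<open>P = y\<close>, shows that the coefficients of \<open>g\<close>
  lie in \<open>k\<close>, so \<open>k(P, Q) = k(P, V)\<close>. In the new coordinates \<open>V = A(f) / f\<^sup>2\<close>, where \<open>A\<close> is a sextic
  in \<open>f\<close> with coefficients in \<open>\<int>[P]\<close>, leading coefficient \<open>197\<close> and constant term
  \<open>- 4 P\<^sup>4 (P + 1)\<^sup>2\<close> (\<open>sextic_pinchuk\<close>). The three claims are properties of this rational function
  of \<open>f\<close>.

  \<^item> Degree. The element \<open>f\<close> is a root of the polynomial \<open>A(T) - V T\<^sup>2\<close> of degree \<open>6\<close>, and since \<open>A(f)\<close>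
    and \<open>f\<^sup>2\<close> are coprime, \<open>1, f, \<dots>, f\<^sup>5\<close> are independent over the field generated by their quotient
    (\<open>powers_independent_over_rational_function\<close>).

  \<^item> Automorphisms. The image \<open>r\<close> of \<open>f\<close> is a rational function of \<open>f\<close> with \<open>A(r) / r\<^sup>2 = A(f) / f\<^sup>2\<close>.
    The right-hand side has a pole of order two at \<open>0\<close>, one of order four at \<open>\<infinity>\<close> and no others, so
    \<open>r\<close> has its only zero at \<open>0\<close> and its only pole at \<open>\<infinity>\<close>, both simple, that is, \<open>r = c f\<close>. The
    terms of degree \<open>0\<close> and \<open>5\<close> of \<open>A\<close> then give \<open>c\<^sup>2 = 1\<close> and \<open>c\<^sup>3 = 1\<close>
    (\<open>rational_reparametrization_trivial\<close>).

  \<^item> Real fibres. Fix \<open>P = a\<close>. By the Jacobian condition and \<open>j(P, f) = f\<close>, the derivative of \<open>V\<close>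
    with respect to \<open>f\<close> is \<open>4 J / f\<close> with \<open>J > 0\<close>. So \<open>V\<close> is injective on each of the half-lines
    \<open>f > 0\<close> and \<open>f < 0\<close>; it tends to \<open>-\<infinity>\<close> at \<open>0\<close> and to \<open>\<infinity>\<close> at \<open>\<plusminus>\<infinity>\<close>, so on each half-line
    it takes every value exactly once (\<open>sextic_level_set\<close>). Real pairs \<open>(f, P)\<close> correspond to real
    points \<open>(x, y)\<close> except where one of \<open>f\<close>, \<open>h\<close>, \<open>h + 1\<close>, \<open>t\<close> vanishes, and this locus maps into
    an algebraic curve.

  The two algebraic claims concern rational functions over \<open>\<real>(P)\<close>. They are reduced to rational
  functions over \<open>\<real>\<close> by evaluating polynomial identities in \<open>x\<close> and \<open>y\<close> at the real points with
  \<open>P = a\<close>, for infinitely many \<open>a\<close> (\<open>pinchuk_point\<close>).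
\<close>

section \<open>Evaluation and substitution of bivariate polynomials\<close>

lemma eval2_simps [simp]:
  "eval2 0 w = 0" "eval2 1 w = 1" "eval2 (numeral n) w = numeral n"
  "eval2 (p + p') w = eval2 p w + eval2 p' w"
  "eval2 (p - p') w = eval2 p w - eval2 p' w"
  "eval2 (- p) w = - eval2 p w"
  "eval2 (p * p') w = eval2 p w * eval2 p' w"
  "eval2 (p ^ m) w = eval2 p w ^ m"
  "eval2 (const2 c) w = c" "eval2 varX w = fst w" "eval2 varY w = snd w"
  by (simp_all add: eval2_def const2_def varX_def varY_def)

lemma eval2_sum: "eval2 (\<Sum>i\<in>A. g i) w = (\<Sum>i\<in>A. eval2 (g i) w)"
  by (induction A rule: infinite_finite_induct) simp_all

lemma poly_0_if_cofinitely_many_roots: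
  fixes p :: "'a :: {idom, ring_char_0} poly"
  assumes "finite B" and "\<And>x. x \<notin> B \<Longrightarrow> poly p x = 0"
  shows "p = 0"
proof (rule ccontr)
  assume "p \<noteq> 0"
  then have "finite ({x. poly p x = 0} \<union> B)"
    using poly_roots_finite assms(1) by blast
  moreover have "{x. poly p x = 0} \<union> B = UNIV"
    using assms(2) by blast
  ultimately show False
    by (simp add: infinite_UNIV_char_0)
qed

lemma poly_poly_0_if_infinitely_many_roots:
  fixes p :: "'a :: idom poly poly"
  assumes "infinite A" and "\<And>a. a \<in> A \<Longrightarrow> poly p [:a:] = 0"
  shows "p = 0"
proof (rule ccontr)
  assume "p \<noteq> 0"
  then have "finite {x. poly p x = 0}"
    by (rule poly_roots_finite)
  moreover have "(\<lambda>a. [:a:]) ` A \<subseteq> {x. poly p x = 0}"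
    using assms(2) by blast
  ultimately have "finite ((\<lambda>a. [:a:]) ` A)"
    using finite_subset by blast
  moreover have "inj_on (\<lambda>a. [:a:]) A"
    by (simp add: inj_on_def)
  ultimately show False
    using assms(1) finite_imageD by blast
qed

text \<open>
  A polynomial is determined by its values at all points off finitely many exceptions on each of
  infinitely many horizontal lines.
\<close>

lemma eval2_0_imp_0:
  assumes "infinite A" and "\<And>a. a \<in> A \<Longrightarrow> finite (B a)"
    and "\<And>a s. a \<in> A \<Longrightarrow> s \<notin> B a \<Longrightarrow> eval2 p (s, a) = 0"
  shows "p = 0"
proof (rule poly_poly_0_if_infinitely_many_roots[OF assms(1)])
  fix a assume "a \<in> A"
  then show "poly p [:a:] = 0"
    using assms(2,3)[of a] by (intro poly_0_if_cofinitely_many_roots[of "B a"]) (auto simp: eval2_def)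
qed

lemma eval2_eqI:
  assumes "\<And>w. eval2 p w = eval2 p' w"
  shows "p = p'"
  using eval2_0_imp_0[of UNIV "\<lambda>_. {}" "p - p'"] assms by (simp add: infinite_UNIV_char_0)

text \<open>
  Evaluation is a homomorphism and separates polynomials, so these identities, and those for
  \<open>subst2\<close> below, reduce to identities between real numbers.
\<close>

lemma const2_simps [simp]:
  "const2 0 = 0" "const2 1 = 1" "const2 (c + d) = const2 c + const2 d"
  "const2 (c - d) = const2 c - const2 d" "const2 (- c) = - const2 c"
  "const2 (c * d) = const2 c * const2 d" "const2 (numeral n) = numeral n"
  by (rule eval2_eqI; simp)+

lemma eval2_poly_const2:
  "eval2 (poly (map_poly const2 g) p) w = poly g (eval2 p w)"
  by (induction g) (simp_all add: map_poly_pCons)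

lemma eval2_subst2: "eval2 (subst2 p a b) w = eval2 p (eval2 a w, eval2 b w)"
proof (induction p)
  case 0
  then show ?case by (simp add: subst2_def eval2_def)
next
  case (pCons c p)
  then show ?case
    by (simp add: subst2_def map_poly_pCons eval2_poly_const2) (simp add: eval2_def)
qed

lemma subst2_simps [simp]:
  "subst2 0 a b = 0" "subst2 1 a b = 1"
  "subst2 (p + p') a b = subst2 p a b + subst2 p' a b"
  "subst2 (p - p') a b = subst2 p a b - subst2 p' a b"
  "subst2 (- p) a b = - subst2 p a b"
  "subst2 (p * p') a b = subst2 p a b * subst2 p' a b"
  "subst2 (p ^ m) a b = subst2 p a b ^ m"
  "subst2 (const2 c) a b = const2 c" "subst2 varX a b = a" "subst2 varY a b = b"
  "subst2 (numeral n) a b = numeral n"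
  "subst2 (subst2 p a' b') a b = subst2 p (subst2 a' a b) (subst2 b' a b)"
  by (rule eval2_eqI; simp add: eval2_subst2)+

section \<open>Derivations and the Jacobian determinant\<close>

lemma map_poly_pderiv_mult:
  fixes p p' :: "'a :: idom poly poly"
  shows "map_poly pderiv (p * p') = map_poly pderiv p * p' + p * map_poly pderiv p'"
proof (induction p)
  case 0
  then show ?case by simp
next
  case (pCons c p)
  have add: "map_poly pderiv (q + r) = map_poly pderiv q + map_poly pderiv r" for q r :: "'a poly poly"
    by (intro poly_eqI) (simp add: coeff_map_poly pderiv_add)
  have smult: "map_poly pderiv (smult c q) = smult (pderiv c) q + smult c (map_poly pderiv q)"
    for q :: "'a poly poly"
    by (intro poly_eqI) (simp add: coeff_map_poly pderiv_mult algebra_simps)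
  show ?case
    by (simp add: add smult map_poly_pCons pCons.IH)
qed

lemma partialX_simps [simp]:
  "partialX 0 = 0" "partialX 1 = 0"
  "partialX (p + p') = partialX p + partialX p'"
  "partialX (p - p') = partialX p - partialX p'"
  "partialX (- p) = - partialX p"
  "partialX (p * p') = partialX p * p' + p * partialX p'"
  "partialX (const2 c) = 0" "partialX varX = 1" "partialX varY = 0"
  by (auto intro!: poly_eqI simp: partialX_def coeff_map_poly pderiv_add pderiv_diff pderiv_minus
      map_poly_pderiv_mult const2_def varX_def varY_def map_poly_pCons pderiv_pCons
      simp flip: one_pCons)

lemma partialY_simps [simp]:
  "partialY 0 = 0" "partialY 1 = 0"
  "partialY (p + p') = partialY p + partialY p'"
  "partialY (p - p') = partialY p - partialY p'"
  "partialY (- p) = - partialY p"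
  "partialY (p * p') = partialY p * p' + p * partialY p'"
  "partialY (const2 c) = 0" "partialY varX = 0" "partialY varY = 1"
  by (simp_all add: partialY_def pderiv_add pderiv_diff pderiv_minus pderiv_mult
      const2_def varX_def varY_def pderiv_pCons algebra_simps)

lemma jacobian_simps [simp]:
  "jacobian r 0 = 0" "jacobian r 1 = 0" "jacobian r (const2 c) = 0" "jacobian r r = 0"
  "jacobian r (p + p') = jacobian r p + jacobian r p'"
  "jacobian r (p - p') = jacobian r p - jacobian r p'"
  "jacobian r (- p) = - jacobian r p"
  "jacobian r (p * p') = jacobian r p * p' + p * jacobian r p'"
  "jacobian (p + p') r = jacobian p r + jacobian p' r"
  by (simp_all add: jacobian_def algebra_simps)

lemma jacobian_numeral [simp]: "jacobian r (numeral n) = 0"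
  using jacobian_simps(3)[of r "numeral n"] by (simp del: jacobian_simps)

lemma jacobian_power [simp]:
  "jacobian r (p ^ Suc m) = of_nat (Suc m) * p ^ m * jacobian r p"
  by (induction m) (simp_all add: algebra_simps)

lemma jacobian_power_numeral [simp]:
  "jacobian r (p ^ numeral m) = numeral m * p ^ pred_numeral m * jacobian r p"
  using jacobian_power[of r p "pred_numeral m"] by (simp del: jacobian_power flip: numeral_eq_Suc)

text \<open>
  The chain rule for the derivation \<open>jacobian r\<close>.
\<close>

lemma jacobian_subst2:
  "jacobian r (subst2 p a b) =
     subst2 (partialX p) a b * jacobian r a + subst2 (partialY p) a b * jacobian r b"
proof -
  have inner: "jacobian r (poly (map_poly const2 c) a) = poly (map_poly const2 (pderiv c)) a * jacobian r a"
    for c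
  proof (induction c)
    case 0
    then show ?case by simp
  next
    case (pCons d c)
    have "map_poly const2 (x + y) = map_poly const2 x + map_poly const2 y" for x y
      by (intro poly_eqI) (simp add: coeff_map_poly)
    then show ?case
      using pCons.IH by (simp add: map_poly_pCons pderiv_pCons algebra_simps)
  qed
  show ?thesis
  proof (induction p)
    case 0
    then show ?case by simp
  next
    case (pCons c p)
    have p: "pCons c p = [:c:] + varY * p"
      by (simp add: varY_def)
    have c: "subst2 [:d:] a b = poly (map_poly const2 d) a" for d
      by (simp add: subst2_def map_poly_pCons)
    have "partialX [:c:] = [:pderiv c:]" "partialY [:c:] = 0"
      by (simp_all add: partialX_def partialY_def map_poly_pCons)
    then show ?case
      unfolding p by (simp add: c inner pCons.IH algebra_simps)
  qed
qed

section \<open>The Pinchuk polynomials\<close>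

definition pinchuk_P :: "real poly poly"
  where "pinchuk_P = pinchuk_f + pinchuk_h"

text \<open>
  Four times one admissible choice of the polynomial \<open>u\<close> in the definition of a Pinchuk map
  (\<open>jacobian_P_V\<close>). The factor makes all coefficients integers, so that the formulas make sense in every
  commutative ring: they are used over \<open>\<real>\<close>, \<open>\<real>[x, y]\<close> and \<open>\<real>(x, y)\<close>.
\<close>

definition pinchuk_correction :: "'a :: comm_ring_1 \<Rightarrow> 'a \<Rightarrow> 'a"
  where "pinchuk_correction s h =
    680 * s * h + 364 * h^2 + 780 * s * h^2 + 276 * h^3 + 300 * s * h^3 + 75 * h^4"

definition pinchuk_V :: "real poly poly"
  where "pinchuk_V = 4 * pinchuk_q - pinchuk_correction pinchuk_f pinchuk_h"

text \<open>
  The numerator of \<open>V\<close> as a rational function of \<open>f\<close> with denominator \<open>f\<^sup>2\<close>, where \<open>a\<close> stands for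
  \<open>P\<close>; see \<open>sextic_eq\<close>.
\<close>

definition sextic :: "'a :: comm_ring_1 \<Rightarrow> 'a poly"
  where "sextic a =
    [:- 4 * (a^2 * (a + 1))^2, 48 * a^3 * (a + 1)^2, - (512 * a^2 + 604 * a^3 + 255 * a^4),
      216 * a + 536 * a^2 + 320 * a^3, 252 + 396 * a + 150 * a^2, - (416 + 456 * a), 197:]"

lemma pinchuk_f_h_t: "(pinchuk_h - pinchuk_t) * pinchuk_f = pinchuk_h^2 * (pinchuk_h + 1)"
  by (rule eval2_eqI) (simp add: pinchuk_f_def pinchuk_h_def pinchuk_t_def, Groebner_Basis.algebra)

lemma pinchuk_h_alt: "pinchuk_h - pinchuk_t = varX * pinchuk_t^2"
  by (simp add: pinchuk_h_def algebra_simps power2_eq_square)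

text \<open>
  The hypothesis gives \<open>t s = h s - h\<^sup>2 (h + 1)\<close>, which eliminates \<open>t\<close> after multiplication by
  \<open>s\<^sup>2\<close>.
\<close>

lemma sextic_eq:
  fixes s h t :: "'a :: comm_ring_1"
  assumes "(h - t) * s = h^2 * (h + 1)"
  shows "poly (sextic (s + h)) s =
    (4 * (- (t^2) - 6 * t * h * (h + 1)) - pinchuk_correction s h) * s^2"
proof -
  define m where "m = h * s - h^2 * (h + 1)"
  have m: "t * s = m"
    using assms by (simp add: m_def algebra_simps)
  have "(4 * (- (t^2) - 6 * t * h * (h + 1)) - pinchuk_correction s h) * s^2 =
    4 * (- ((t * s)^2) - 6 * (t * s) * s * h * (h + 1)) - pinchuk_correction s h * s^2"
    by (simp add: algebra_simps power2_eq_square)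
  also have "\<dots> = poly (sextic (s + h)) s"
    unfolding m unfolding m_def
    by (simp add: sextic_def pinchuk_correction_def algebra_simps eval_nat_numeral)
  finally show ?thesis ..
qed

lemma sextic_pinchuk: "poly (sextic pinchuk_P) pinchuk_f = pinchuk_V * pinchuk_f^2"
  using sextic_eq[OF pinchuk_f_h_t] by (simp add: pinchuk_P_def pinchuk_V_def pinchuk_q_def)

lemma jacobian_h_f: "jacobian pinchuk_h pinchuk_f = pinchuk_f"
  by (rule eval2_eqI)
    (simp add: pinchuk_f_def pinchuk_h_def pinchuk_t_def power2_eq_square jacobian_def,
      Groebner_Basis.algebra)

lemma jacobian_skew: "jacobian p r = - jacobian r p"
  by (simp add: jacobian_def)

lemma jacobian_P_f: "jacobian pinchuk_P pinchuk_f = pinchuk_f"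
  and jacobian_P_h: "jacobian pinchuk_P pinchuk_h = - pinchuk_f"
  using jacobian_h_f jacobian_skew[of pinchuk_f pinchuk_h] by (simp_all add: pinchuk_P_def)

lemma pinchuk_f_nz: "pinchuk_f \<noteq> 0"
proof
  assume "pinchuk_f = 0"
  then have "eval2 pinchuk_f (0, 0) = 0" by simp
  then show False by (simp add: pinchuk_f_def pinchuk_t_def)
qed

text \<open>
  Obtained by applying the derivation \<open>j(P, _)\<close> to the relation between \<open>f\<close>, \<open>h\<close> and \<open>t\<close>, which
  avoids differentiating \<open>t\<close> in terms of \<open>x\<close> and \<open>y\<close>.
\<close>

lemma jacobian_P_t:
  "jacobian pinchuk_P pinchuk_t = 3 * pinchuk_h^2 + 3 * pinchuk_h - pinchuk_t - pinchuk_f"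
proof -
  let ?j = "jacobian pinchuk_P pinchuk_t"
  have "jacobian pinchuk_P ((pinchuk_h - pinchuk_t) * pinchuk_f) =
    jacobian pinchuk_P (pinchuk_h^2 * (pinchuk_h + 1))"
    by (simp only: pinchuk_f_h_t)
  then have "(- pinchuk_f - ?j) * pinchuk_f + (pinchuk_h - pinchuk_t) * pinchuk_f =
    - pinchuk_f * (2 * pinchuk_h * (pinchuk_h + 1) + pinchuk_h^2)"
    by (simp add: jacobian_P_f jacobian_P_h algebra_simps power2_eq_square)
  then have "(?j - (3 * pinchuk_h^2 + 3 * pinchuk_h - pinchuk_t - pinchuk_f)) * pinchuk_f = 0"
    by Groebner_Basis.algebra
  then show ?thesis
    using pinchuk_f_nz by simp
qed

text \<open>
  The Jacobian determinant required of a Pinchuk map. Over the reals it vanishes only where \<open>s = t = 0\<close>.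
\<close>

definition pinchuk_J :: "'a :: comm_ring_1 \<Rightarrow> 'a \<Rightarrow> 'a \<Rightarrow> 'a"
  where "pinchuk_J s h t = t^2 + (t + s * (13 + 15 * h))^2 + s^2"

lemma jacobian_P_V:
  "jacobian pinchuk_P pinchuk_V = 4 * pinchuk_J pinchuk_f pinchuk_h pinchuk_t"
  using pinchuk_f_h_t
  by (simp add: pinchuk_V_def pinchuk_q_def pinchuk_correction_def pinchuk_J_def
       jacobian_P_f jacobian_P_h jacobian_P_t eval_nat_numeral) Groebner_Basis.algebra

section \<open>Real points and algebraic independence\<close>

lemma eval2_P: "eval2 pinchuk_P w = eval2 pinchuk_f w + eval2 pinchuk_h w"
  by (simp add: pinchuk_P_def)

lemma eval2_f_h_t:
  "(eval2 pinchuk_h w - eval2 pinchuk_t w) * eval2 pinchuk_f w =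
    eval2 pinchuk_h w ^ 2 * (eval2 pinchuk_h w + 1)"
  using arg_cong[OF pinchuk_f_h_t, of "\<lambda>p. eval2 p w"] by simp

lemma eval2_V:
  "eval2 pinchuk_V w * eval2 pinchuk_f w ^ 2 = poly (sextic (eval2 pinchuk_P w)) (eval2 pinchuk_f w)"
  unfolding eval2_P sextic_eq[OF eval2_f_h_t]
  by (simp add: pinchuk_V_def pinchuk_q_def pinchuk_correction_def)

text \<open>
  The relations \<open>(h - t) s = h\<^sup>2 (h + 1)\<close>, \<open>x t\<^sup>2 = h - t\<close> and \<open>x y = t + 1\<close> can be solved for
  \<open>t\<close>, \<open>x\<close> and \<open>y\<close> in turn. The conditions on \<open>s\<close> and \<open>h\<close> ensure \<open>t \<noteq> 0\<close> and \<open>h \<noteq> t\<close>, hence \<open>x \<noteq> 0\<close>.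
\<close>

lemma pinchuk_point_exists:
  fixes s h :: real
  assumes "s \<noteq> 0" "h \<noteq> 0" "h \<noteq> -1" "s \<noteq> h^2 + h"
  obtains w where "eval2 pinchuk_f w = s" "eval2 pinchuk_h w = h"
proof -
  define t where "t = h - h^2 * (h + 1) / s"
  define x where "x = (h - t) / t^2"
  define y where "y = (t + 1) / x"
  have "t * s = h * (s - (h^2 + h))"
    using assms by (simp add: t_def field_simps power2_eq_square)
  then have t: "t \<noteq> 0"
    using assms by auto
  have hts: "(h - t) * s = h^2 * (h + 1)"
    using assms by (simp add: t_def)
  then have ht: "h - t \<noteq> 0"
    using assms by auto
  then have xy: "x * y = t + 1" and xt: "x * t^2 = h - t"
    using t by (simp_all add: x_def y_def)
  have et: "eval2 pinchuk_t (x, y) = t"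
    by (simp add: pinchuk_t_def xy)
  have eh: "eval2 pinchuk_h (x, y) = h"
    using xt by (simp add: pinchuk_h_def et algebra_simps power2_eq_square)
  have "(h - t) * eval2 pinchuk_f (x, y) = (h - t) * s"
    using eval2_f_h_t[of "(x, y)"] by (simp add: et eh hts)
  then have "eval2 pinchuk_f (x, y) = s"
    using ht by simp
  then show ?thesis
    using that eh by blast
qed

lemma pinchuk_point_unique:
  assumes "eval2 pinchuk_f w = eval2 pinchuk_f w'" "eval2 pinchuk_h w = eval2 pinchuk_h w'"
    and f: "eval2 pinchuk_f w \<noteq> 0" and t: "eval2 pinchuk_t w \<noteq> 0" and h: "eval2 pinchuk_h w \<noteq> -1"
  shows "w = w'"
proof -
  obtain x y x' y' where w: "w = (x, y)" "w' = (x', y')"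
    by (metis surj_pair)
  have tt: "eval2 pinchuk_t w' = eval2 pinchuk_t w"
    using eval2_f_h_t[of w] eval2_f_h_t[of w'] f unfolding assms(1,2) by (simp add: algebra_simps)
  have "eval2 (pinchuk_h - pinchuk_t) v = fst v * eval2 pinchuk_t v ^ 2" for v
    by (simp only: pinchuk_h_alt eval2_simps)
  from this[of w] this[of w'] have "x * eval2 pinchuk_t w ^ 2 = x' * eval2 pinchuk_t w ^ 2"
    by (simp add: w(1)[symmetric] w(2)[symmetric] tt assms(2)) (simp add: w)
  then have x: "x = x'"
    using t by simp
  have "x * y = x' * y'"
    using tt by (simp add: w pinchuk_t_def)
  moreover have "x \<noteq> 0"
    using h by (auto simp: w pinchuk_t_def pinchuk_h_def)
  ultimately show ?thesis
    using x by (simp add: w)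
qed

text \<open>
  The values of \<open>f\<close> on the line \<open>P = a\<close> for which the solution in \<open>pinchuk_point_exists\<close> breaks down.
\<close>

definition exceptional :: "real \<Rightarrow> real set"
  where "exceptional a = {s. s = 0 \<or> a - s = 0 \<or> a - s = -1 \<or> s = (a - s)^2 + (a - s)}"

lemma finite_exceptional: "finite (exceptional a)"
proof -
  have "{s. s = (a - s)^2 + (a - s)} = {s. poly [:a^2 + a, - (2 * a + 2), 1:] s = 0}"
    by (auto simp: algebra_simps power2_eq_square)
  moreover have "finite \<dots>"
    by (rule poly_roots_finite) simp
  moreover have "exceptional a \<subseteq> {0, a, a + 1} \<union> {s. s = (a - s)^2 + (a - s)}"
    by (auto simp: exceptional_def)
  ultimately show ?thesis
    using finite_subset by auto
qed

lemma pinchuk_point: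
  assumes "s \<notin> exceptional a"
  obtains w where "eval2 pinchuk_f w = s" "eval2 pinchuk_P w = a"
    "eval2 pinchuk_V w = poly (sextic a) s / s^2"
proof -
  obtain w where w: "eval2 pinchuk_f w = s" "eval2 pinchuk_h w = a - s"
    using pinchuk_point_exists[of s "a - s"] assms by (auto simp: exceptional_def)
  then have "eval2 pinchuk_P w = a"
    by (simp add: eval2_P)
  then show ?thesis
    using that[of w] w eval2_V[of w] assms by (auto simp: field_simps exceptional_def)
qed

text \<open>
  The points \<open>(f, P)\<close> of the real plane that come from real points \<open>(x, y)\<close> are Zariski dense.
\<close>

lemma algebraically_independent:
  assumes "subst2 p pinchuk_f pinchuk_P = 0"
  shows "p = 0"
proof (rule eval2_0_imp_0[of UNIV exceptional])
  fix a s assume "s \<notin> exceptional a"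
  then obtain w where "eval2 pinchuk_f w = s" "eval2 pinchuk_P w = a"
    by (rule pinchuk_point)
  then show "eval2 p (s, a) = 0"
    using arg_cong[OF assms, of "\<lambda>p. eval2 p w"] by (simp add: eval2_subst2)
qed (simp_all add: infinite_UNIV_char_0 finite_exceptional)

text \<open>
  The derivation \<open>j(P, _)\<close> acts on \<open>\<real>[f, P]\<close> as \<open>f \<partial>/\<partial>f\<close>.
\<close>

lemma polynomial_in_P_if_jacobian_0:
  assumes "jacobian pinchuk_P (subst2 p pinchuk_f pinchuk_P) = 0"
  obtains g where "subst2 p pinchuk_f pinchuk_P = poly (map_poly const2 g) pinchuk_P"
proof -
  have "partialX p = 0"
    by (rule algebraically_independent)
      (use assms pinchuk_f_nz in \<open>simp add: jacobian_subst2 jacobian_P_f\<close>)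
  then have c: "poly.coeff (partialX p) i = 0" for i
    by simp
  have "\<exists>d. poly.coeff p i = [:d:]" for i
    using c[of i] degree_eq_zeroE[of "poly.coeff p i"]
    by (simp add: partialX_def coeff_map_poly pderiv_eq_0_iff) metis
  then have "p = map_poly (\<lambda>d. [:d:]) (map_poly (\<lambda>c. poly.coeff c 0) p)"
    by (intro poly_eqI) (simp add: coeff_map_poly, metis coeff_pCons_0)
  define g where "g = map_poly (\<lambda>c. poly.coeff c 0) p"
  have p: "p = map_poly (\<lambda>d. [:d:]) g"
    unfolding g_def by fact
  have "map_poly (\<lambda>c. poly (map_poly const2 c) a) p = map_poly const2 g" for a
    unfolding p by (subst map_poly_map_poly) (auto simp: o_def map_poly_pCons)
  then have "subst2 p pinchuk_f pinchuk_P = poly (map_poly const2 g) pinchuk_P"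
    by (simp add: subst2_def)
  then show ?thesis ..
qed

text \<open>
  Both \<open>4 Q\<close> and \<open>V\<close> have Jacobian determinant \<open>4 J\<close> with \<open>P\<close>, and both are \<open>4 q\<close> minus a
  polynomial in \<open>f\<close> and \<open>h\<close>, so their difference is a polynomial in \<open>f\<close> and \<open>P\<close> killed by
  \<open>j(P, _)\<close>.
\<close>

lemma pinchuk_map_normal_form:
  assumes "pinchuk_map P Q"
  obtains g where "P = pinchuk_P" "4 * Q = pinchuk_V - poly (map_poly const2 g) pinchuk_P"
proof -
  from assms obtain u where P: "P = pinchuk_P" and Q: "Q = pinchuk_q - subst2 u pinchuk_f pinchuk_h"
    and J: "jacobian P Q = pinchuk_J pinchuk_f pinchuk_h pinchuk_t"
    by (auto simp: pinchuk_map_def pinchuk_P_def pinchuk_J_def)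
  define v where
    "v = 4 * subst2 u varX (varY - varX) - pinchuk_correction varX (varY - varX)"
  have v: "subst2 v pinchuk_f pinchuk_P = pinchuk_V - 4 * Q"
    by (simp add: v_def Q pinchuk_V_def pinchuk_correction_def) (simp add: pinchuk_P_def)
  then have "jacobian pinchuk_P (subst2 v pinchuk_f pinchuk_P) = 0"
    using J by (simp add: P jacobian_P_V)
  then obtain g where "subst2 v pinchuk_f pinchuk_P = poly (map_poly const2 g) pinchuk_P"
    by (rule polynomial_in_P_if_jacobian_0)
  then have "4 * Q = pinchuk_V - poly (map_poly const2 g) pinchuk_P"
    using v by (simp add: algebra_simps)
  then show ?thesis
    using that P by blast
qed

section \<open>Generically two real preimages\<close>

lemma sextic_0: "poly (sextic a) 0 = - 4 * (a^2 * (a + 1))^2"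
  by (simp add: sextic_def)

lemma inj_on_half_lines_if_deriv_has_sign_of_argument:
  fixes r r' :: "real \<Rightarrow> real"
  assumes deriv: "\<And>s. s \<noteq> 0 \<Longrightarrow> (r has_real_derivative r' s) (at s)"
    and pos: "\<And>s. s \<noteq> 0 \<Longrightarrow> 0 < s * r' s"
    and "s \<noteq> 0" "s' \<noteq> 0" "sgn s = sgn s'" "r s = r s'"
  shows "s = s'"
proof -
  have *: False if uv: "u < v" and sg: "0 < u \<or> v < 0" and eq: "r u = r v" for u v
  proof -
    have "\<exists>z. u < z \<and> z < v \<and> r v - r u = (v - u) * r' z"
      using uv sg by (intro MVT2) (auto intro: deriv)
    then obtain z where z: "u < z" "z < v" "r' z = 0"
      using eq uv by auto
    then have "z \<noteq> 0"
      using sg by auto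
    then show False
      using pos[of z] z(3) by simp
  qed
  show ?thesis
    using *[of s s'] *[of s' s] assms(3-6)
    by (cases s s' rule: linorder_cases) (auto simp: sgn_if split: if_splits)
qed

text \<open>
  On the line \<open>P = a\<close> this is the identity \<open>j(P, V) = 4 J\<close> divided by \<open>j(P, f) = f\<close>. It is proved
  by direct differentiation for every \<open>s \<noteq> 0\<close>, as not every such \<open>s\<close> is the value of \<open>f\<close> at a real
  point.
\<close>

lemma sextic_quotient_deriv:
  fixes a s :: real
  assumes "s \<noteq> 0"
  shows "((\<lambda>s. poly (sextic a) s / s^2) has_real_derivative
    4 * pinchuk_J s (a - s) (a - s - (a - s)^2 * (a - s + 1) / s) / s) (at s)"
proof -
  define h where "h z = a - z" for z
  define t where "t z = h z - h z^2 * (h z + 1) / z" for z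
  define V where "V z = 4 * (- (t z ^2) - 6 * t z * h z * (h z + 1)) - pinchuk_correction z (h z)" for z
  \<comment> \<open>the derivative of \<open>t\<close>, in the form suggested by \<open>jacobian_P_t\<close>\<close>
  define D where "D = (3 * h s^2 + 3 * h s - t s - s) / s"
  have ht: "(h z - t z) * z = h z ^ 2 * (h z + 1)" if "z \<noteq> 0" for z
    using that by (simp add: t_def)
  have "poly (sextic a) z / z^2 = V z" if "z \<noteq> 0" for z
  proof -
    have "poly (sextic a) z = V z * z^2"
      using sextic_eq[OF ht[OF that]] by (simp add: V_def h_def)
    then show ?thesis
      using that by simp
  qed
  then have ev: "\<forall>\<^sub>F z in nhds s. poly (sextic a) z / z^2 = V z"
    using assms t1_space_nhds[of s 0] by (auto elim: eventually_mono)
  have dh: "(h has_real_derivative - 1) (at s)"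
    unfolding h_def by (auto intro!: derivative_eq_intros)
  have D: "D * s = 3 * h s^2 + 3 * h s - t s - s"
    using assms by (simp add: D_def)
  have "(t has_real_derivative
      - 1 - ((2 * h s * (- 1) * (h s + 1) + h s^2 * (- 1)) * s - h s^2 * (h s + 1)) / (s * s)) (at s)"
    (is "(t has_real_derivative ?D) _")
    unfolding t_def[abs_def] using assms by (auto intro!: derivative_eq_intros dh)
  moreover have "?D * (s * s) = D * (s * s)"
    using assms ht[OF assms] D by (simp add: left_diff_distrib) Groebner_Basis.algebra
  ultimately have dt: "(t has_real_derivative D) (at s)"
    using assms by simp
  have "(V has_real_derivative
      4 * (- (2 * t s * D) - 6 * (D * h s * (h s + 1) - t s * (2 * h s + 1)))
      - (680 * (h s - s) - 728 * h s + 780 * (h s^2 - 2 * s * h s) - 828 * h s^2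
         + 300 * (h s^3 - 3 * s * h s^2) - 300 * h s^3)) (at s)"
    unfolding V_def[abs_def] pinchuk_correction_def
    by (rule derivative_eq_intros dt dh refl)+ (simp add: algebra_simps eval_nat_numeral)
  moreover have "4 * (- (2 * t s * D) - 6 * (D * h s * (h s + 1) - t s * (2 * h s + 1)))
      - (680 * (h s - s) - 728 * h s + 780 * (h s^2 - 2 * s * h s) - 828 * h s^2
         + 300 * (h s^3 - 3 * s * h s^2) - 300 * h s^3) = 4 * pinchuk_J s (h s) (t s) / s" (is "?l = ?r")
  proof -
    have "?l * s = 4 * pinchuk_J s (h s) (t s)"
      using ht[OF assms] D unfolding pinchuk_J_def by Groebner_Basis.algebra
    then show ?thesis
      using assms by (simp add: eq_divide_eq)
  qed
  ultimately have "(V has_real_derivative 4 * pinchuk_J s (h s) (t s) / s) (at s)"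
    by simp
  then show ?thesis
    unfolding DERIV_cong_ev[OF refl ev refl] by (simp add: t_def h_def)
qed

lemma pinchuk_J_pos:
  fixes s :: real
  assumes "s \<noteq> 0"
  shows "pinchuk_J s h t > 0"
  unfolding pinchuk_J_def using assms by (intro add_nonneg_pos add_nonneg_nonneg) simp_all

lemma sextic_quotient_inj:
  fixes a s s' :: real
  assumes "s \<noteq> 0" "s' \<noteq> 0" "sgn s = sgn s'"
    and "poly (sextic a) s / s^2 = poly (sextic a) s' / s'^2"
  shows "s = s'"
proof (rule inj_on_half_lines_if_deriv_has_sign_of_argument[where r = "\<lambda>s. poly (sextic a) s / s^2"])
  show "((\<lambda>s. poly (sextic a) s / s^2) has_real_derivative
    4 * pinchuk_J s (a - s) (a - s - (a - s)^2 * (a - s + 1) / s) / s) (at s)" if "s \<noteq> 0" for s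
    using that by (rule sextic_quotient_deriv)
qed (use assms in \<open>simp_all add: pinchuk_J_pos\<close>)

lemma sextic_positive_far_out:
  fixes a v :: real
  shows "\<exists>n. \<forall>x\<ge>n. poly (sextic a) x - v * x^2 > 0"
    and "\<exists>n. \<forall>x\<ge>n. poly (sextic a) (- x) - v * x^2 > 0"
proof -
  have s: "sextic a = [:poly.coeff (sextic a) 0, poly.coeff (sextic a) 1, poly.coeff (sextic a) 2,
    poly.coeff (sextic a) 3, poly.coeff (sextic a) 4, poly.coeff (sextic a) 5, 197:]"
    by (simp add: sextic_def numeral_eq_Suc)
  obtain c0 c1 c2 c3 c4 c5 where c: "sextic a = [:c0, c1, c2, c3, c4, c5, 197:]"
    using s by blast
  define p where "p = [:c0, c1, c2 - v, c3, c4, c5, 197:]"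
  define p' where "p' = [:c0, - c1, c2 - v, - c3, c4, - c5, 197:]"
  have "\<exists>n. \<forall>x\<ge>n. Polynomial.lead_coeff p \<le> poly p x" "\<exists>n. \<forall>x\<ge>n. Polynomial.lead_coeff p' \<le> poly p' x"
    by (rule poly_pinfty_gt_lc; simp add: p_def p'_def)+
  moreover have "poly (sextic a) x - v * x^2 = poly p x"
      "poly (sextic a) (- x) - v * x^2 = poly p' x" for x
    by (simp_all add: c p_def p'_def algebra_simps power2_eq_square)
  moreover have "Polynomial.lead_coeff p = 197" "Polynomial.lead_coeff p' = 197"
    by (simp_all add: p_def p'_def)
  ultimately show "\<exists>n. \<forall>x\<ge>n. poly (sextic a) x - v * x^2 > 0"
    "\<exists>n. \<forall>x\<ge>n. poly (sextic a) (- x) - v * x^2 > 0"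
    by (metis less_le_trans zero_less_numeral)+
qed

text \<open>
  The polynomial \<open>sextic a - v s\<^sup>2\<close> is negative at \<open>0\<close> and positive far out in both directions,
  which gives one root on each side; monotonicity of the quotient excludes further ones.
\<close>

lemma sextic_level_set:
  fixes a v :: real
  assumes "a \<noteq> 0" "a \<noteq> -1"
  shows "\<exists>s1 s2. s1 \<noteq> s2 \<and> {s. s \<noteq> 0 \<and> poly (sextic a) s = v * s^2} = {s1, s2}"
proof -
  define g where "g s = poly (sextic a) s - v * s^2" for s
  have g0: "g 0 < 0"
    using assms by (simp add: g_def sextic_0)
  have cont: "isCont g s" for s
    unfolding g_def by (intro continuous_intros)
  have cont': "isCont (\<lambda>s. g (- s)) s" for s
    unfolding g_def by (intro continuous_intros)
  obtain n where n: "\<And>x. x \<ge> n \<Longrightarrow> g x > 0"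
    using sextic_positive_far_out(1)[of a v] by (auto simp: g_def)
  obtain m where m: "\<And>x. x \<ge> m \<Longrightarrow> g (- x) > 0"
    using sextic_positive_far_out(2)[of a v] by (auto simp: g_def)
  have "\<exists>x\<ge>0. x \<le> max 0 n \<and> g x = 0"
    using IVT[of g 0 0 "max 0 n"] g0 n[of "max 0 n"] cont by auto
  then obtain s1 where s1: "s1 \<ge> 0" "g s1 = 0" by blast
  have "\<exists>x\<ge>0. x \<le> max 0 m \<and> g (- x) = 0"
    using IVT[of "\<lambda>x. g (- x)" 0 0 "max 0 m"] g0 m[of "max 0 m"] cont' by auto
  then obtain s2 where s2: "s2 \<ge> 0" "g (- s2) = 0" by blast
  have nz: "s1 > 0" "- s2 < 0"
    using s1 s2 g0 by (metis less_eq_real_def neg_less_0_iff_less neg_0_equal_iff_equal less_irrefl)+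
  have eq: "poly (sextic a) s / s^2 = v" if "g s = 0" "s \<noteq> 0" for s
    using that unfolding g_def by simp
  have "s = s1 \<or> s = - s2" if s: "s \<noteq> 0" "g s = 0" for s
  proof (cases "s > 0")
    case True
    then show ?thesis
      using sextic_quotient_inj[of s s1 a] eq[OF s(2,1)] eq[OF s1(2)] nz by simp
  next
    case False
    then show ?thesis
      using sextic_quotient_inj[of s "- s2" a] eq[OF s(2,1)] eq[OF s2(2)] nz s(1)
      by (simp del: power2_minus)
  qed
  then have "{s. s \<noteq> 0 \<and> g s = 0} = {s1, - s2}"
    using nz s1 s2 by auto
  then have "{s. s \<noteq> 0 \<and> poly (sextic a) s = v * s^2} = {s1, - s2}"
    by (simp add: g_def)
  moreover have "s1 \<noteq> - s2"
    using nz by linarith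
  ultimately show ?thesis
    by blast
qed

text \<open>
  The equation of the curve of pairs \<open>(P, V)\<close> in the case \<open>t = 0\<close>. Then \<open>f = h (h + 1)\<close>, so with
  \<open>c = h + 1\<close> one has \<open>P + 1 = c\<^sup>2\<close>, and \<open>V\<close> is a polynomial in \<open>c\<close>. Separating even and odd powers
  of \<open>c\<close> and squaring eliminates \<open>c\<close>.
\<close>

definition branch_curve :: "'a :: comm_ring_1 \<Rightarrow> 'a \<Rightarrow> 'a"
  where "branch_curve a v =
    (v - (345 * (a + 1)^2 + 234 * (a + 1) - 163))^2 - (a + 1) * (300 * (a + 1)^2 + 116 * (a + 1))^2"

text \<open>
  At a real point with \<open>f = 0\<close> the value of \<open>P\<close> is \<open>0\<close> or \<open>-1\<close>. The last three factors are
  equations of the curves of pairs \<open>(P, V)\<close> given by \<open>h = 0\<close>, by \<open>h = -1\<close> and by \<open>t = 0\<close>.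
\<close>

definition degeneracy :: "'a :: comm_ring_1 \<Rightarrow> 'a \<Rightarrow> 'a"
  where "degeneracy a v = a * (a + 1) * v * (v - 200 * a - 33) * branch_curve a v"

lemma nondegenerate:
  fixes s h t v :: real
  assumes s: "s \<noteq> 0" and rel: "(h - t) * s = h^2 * (h + 1)"
    and v: "v = 4 * (- (t^2) - 6 * t * h * (h + 1)) - pinchuk_correction s h"
    and deg: "degeneracy (s + h) v \<noteq> 0"
  shows "h \<noteq> 0" "h \<noteq> -1" "t \<noteq> 0" "s \<noteq> h^2 + h"
proof -
  show h0: "h \<noteq> 0"
  proof
    assume "h = 0"
    then have "t = 0" using rel s by simp
    then have "v = 0" using \<open>h = 0\<close> v by (simp add: pinchuk_correction_def)
    then show False using deg by (simp add: degeneracy_def)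
  qed
  show h1: "h \<noteq> -1"
  proof
    assume "h = -1"
    then have "t = -1" using rel s by simp
    then have "v - 200 * (s + h) - 33 = 0" using \<open>h = -1\<close> v by (simp add: pinchuk_correction_def)
    then show False using deg by (simp add: degeneracy_def)
  qed
  show t0: "t \<noteq> 0"
  proof
    assume "t = 0"
    then have "h * (s - h * (h + 1)) = 0" using rel by (simp add: algebra_simps power2_eq_square)
    then have s: "s = h * (h + 1)" using h0 by simp
    have "branch_curve (s + h) v = 0" unfolding v \<open>t = 0\<close> s
      by (simp add: branch_curve_def pinchuk_correction_def algebra_simps eval_nat_numeral)
    then show False using deg by (simp add: degeneracy_def)
  qed
  show "s \<noteq> h^2 + h"
  proof
    assume "s = h^2 + h"
    then have "t * s = 0" using rel by (simp add: algebra_simps power2_eq_square)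
    then show False using s t0 by simp
  qed
qed

lemma eval2_f_nz:
  assumes "eval2 pinchuk_P w \<noteq> 0" "eval2 pinchuk_P w \<noteq> -1"
  shows "eval2 pinchuk_f w \<noteq> 0"
proof
  assume f: "eval2 pinchuk_f w = 0"
  obtain x y where w: "w = (x, y)" by fastforce
  define t where "t = x * y - 1"
  have h: "eval2 pinchuk_h w = t * (x * t + 1)"
    by (simp add: w t_def pinchuk_h_def pinchuk_t_def)
  have "(x * t + 1)^2 * (t^2 + y) = 0"
    using f by (simp add: w t_def pinchuk_f_def pinchuk_t_def)
  then consider "x * t + 1 = 0" | "t^2 + y = 0"
    by auto
  then have "eval2 pinchuk_h w = 0 \<or> eval2 pinchuk_h w = -1"
  proof cases
    case 1
    then show ?thesis by (simp add: h)
  next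
    case 2
    then have "t = - x * t^2 - 1"
      unfolding t_def by Groebner_Basis.algebra
    then have "t * (x * t + 1) = -1"
      by Groebner_Basis.algebra
    then show ?thesis by (simp add: h)
  qed
  then show False
    using assms f by (auto simp: eval2_P)
qed

text \<open>
  Off the degeneracy locus the polynomial \<open>f\<close> maps the fibre bijectively onto the set of the real
  numbers \<open>s \<noteq> 0\<close> at which the rational function \<open>sextic a / s\<^sup>2\<close> has the value \<open>v\<close>.
\<close>

lemma card_real_fibre:
  assumes deg: "degeneracy a v \<noteq> 0"
  shows "card {w. eval2 pinchuk_P w = a \<and> eval2 pinchuk_V w = v} = 2"
proof -
  let ?W = "{w. eval2 pinchuk_P w = a \<and> eval2 pinchuk_V w = v}"
  let ?S = "{s. s \<noteq> 0 \<and> poly (sextic a) s = v * s^2}"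
  have a: "a \<noteq> 0" "a \<noteq> -1"
    using deg by (auto simp: degeneracy_def)
  have f: "eval2 pinchuk_f w \<noteq> 0" "a - eval2 pinchuk_f w = eval2 pinchuk_h w"
    "eval2 pinchuk_h w \<noteq> -1" "eval2 pinchuk_t w \<noteq> 0" if "w \<in> ?W" for w
  proof -
    show f: "eval2 pinchuk_f w \<noteq> 0"
      using eval2_f_nz[of w] that a by simp
    have "v = 4 * (- (eval2 pinchuk_t w^2) - 6 * eval2 pinchuk_t w * eval2 pinchuk_h w * (eval2 pinchuk_h w + 1))
      - pinchuk_correction (eval2 pinchuk_f w) (eval2 pinchuk_h w)"
      using that by (auto simp: pinchuk_V_def pinchuk_q_def pinchuk_correction_def)
    from nondegenerate[OF f eval2_f_h_t this] deg that
    show "eval2 pinchuk_h w \<noteq> -1" "eval2 pinchuk_t w \<noteq> 0" by (auto simp: eval2_P)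
    show "a - eval2 pinchuk_f w = eval2 pinchuk_h w"
      using that by (auto simp: eval2_P)
  qed
  have "bij_betw (eval2 pinchuk_f) ?W ?S"
    unfolding bij_betw_def
  proof
    show "inj_on (eval2 pinchuk_f) ?W"
    proof (rule inj_onI)
      fix w w' assume w: "w \<in> ?W" "w' \<in> ?W" and eq: "eval2 pinchuk_f w = eval2 pinchuk_f w'"
      have "eval2 pinchuk_h w = eval2 pinchuk_h w'"
        using f(2)[OF w(1)] f(2)[OF w(2)] eq by linarith
      with eq show "w = w'"
        using f[OF w(1)] by (intro pinchuk_point_unique) auto
    qed
    show "eval2 pinchuk_f ` ?W = ?S"
    proof (intro equalityI subsetI)
      fix s assume "s \<in> eval2 pinchuk_f ` ?W"
      then obtain w where w: "w \<in> ?W" "s = eval2 pinchuk_f w" by blast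
      then show "s \<in> ?S"
        using eval2_V[of w] f(1)[OF w(1)] by auto
    next
      fix s assume s: "s \<in> ?S"
      define h where "h = a - s"
      define t where "t = h - h^2 * (h + 1) / s"
      have rel: "(h - t) * s = h^2 * (h + 1)"
        using s by (simp add: t_def)
      have "v = 4 * (- (t^2) - 6 * t * h * (h + 1)) - pinchuk_correction s h"
        using sextic_eq[OF rel] s by (auto simp: h_def)
      from nondegenerate[OF _ rel this] have "s \<notin> exceptional a"
        using s deg by (auto simp: h_def exceptional_def)
      then obtain w where "eval2 pinchuk_f w = s" "eval2 pinchuk_P w = a"
          "eval2 pinchuk_V w = poly (sextic a) s / s^2"
        by (rule pinchuk_point)
      then show "s \<in> eval2 pinchuk_f ` ?W"
        using s by (intro image_eqI[of _ _ w]) auto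
    qed
  qed
  then have "card ?W = card ?S"
    by (rule bij_betw_same_card)
  also obtain s1 s2 where "s1 \<noteq> s2" "?S = {s1, s2}"
    using sextic_level_set[OF a] by blast
  then have "card ?S = 2" by simp
  finally show ?thesis .
qed

lemma generically_two_to_one_if_normal_form:
  assumes Q: "4 * Q = pinchuk_V - poly (map_poly const2 g) pinchuk_P"
  shows "generically_two_to_one (polynomial_map pinchuk_P Q)"
proof -
  define G where "G = degeneracy varX (4 * varY + [:g:])"
  have g: "eval2 [:g:] w = poly g (fst w)" for w
    by (simp add: eval2_def)
  have G: "eval2 G w = degeneracy (fst w) (4 * snd w + poly g (fst w))" for w
    by (simp add: G_def degeneracy_def branch_curve_def g)
  have "eval2 pinchuk_V w = 4 * eval2 Q w + poly g (eval2 pinchuk_P w)" for w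
    using arg_cong[OF Q, of "\<lambda>p. eval2 p w"] by (simp add: eval2_poly_const2)
  then have fibre: "{v. polynomial_map pinchuk_P Q v = w} =
      {v. eval2 pinchuk_P v = fst w \<and> eval2 pinchuk_V v = 4 * snd w + poly g (fst w)}" for w
    by (auto simp: polynomial_map_def prod_eq_iff)
  \<comment> \<open>The point with \<open>P = -2\<close> and \<open>V = 1\<close>: as \<open>P + 1 < 0\<close>, the branch curve has no real point on
    this line.\<close>
  have "eval2 G (-2, (1 - poly g (-2)) / 4) \<noteq> 0"
    by (simp add: G degeneracy_def branch_curve_def)
  then have "{w. eval2 G w = 0} \<noteq> UNIV"
    by blast
  moreover have "zariski_closed {w. eval2 G w = 0}"
    unfolding zariski_closed_def by (intro exI[of _ "{G}"]) simp
  moreover have "card {v. polynomial_map pinchuk_P Q v = w} = 2" if "w \<notin> {w. eval2 G w = 0}" for w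
    using that unfolding fibre by (intro card_real_fibre) (simp add: G)
  ultimately show ?thesis
    unfolding generically_two_to_one_def by blast
qed

section \<open>Simple extensions of subfields\<close>

lemma ring_of_type_algebra_simps [simp]:
  "carrier ring_of_type_algebra = (UNIV :: 'a :: field set)"
  "x \<otimes>\<^bsub>ring_of_type_algebra\<^esub> y = x * (y :: 'a)"
  "x \<oplus>\<^bsub>ring_of_type_algebra\<^esub> y = x + (y :: 'a)"
  "\<one>\<^bsub>ring_of_type_algebra\<^esub> = (1 :: 'a)"
  "\<zero>\<^bsub>ring_of_type_algebra\<^esub> = (0 :: 'a)"
  by (simp_all add: ring_of_type_algebra_def)

lemma pow_ring_of_type_algebra [simp]:
  "(x :: 'a :: field) [^]\<^bsub>ring_of_type_algebra\<^esub> (n :: nat) = x ^ n"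
proof -
  interpret R: field "ring_of_type_algebra :: 'a ring" ..
  show ?thesis
    by (induction n) (simp_all add: R.nat_pow_Suc)
qed

lemma a_inv_ring_of_type_algebra [simp]:
  "\<ominus>\<^bsub>ring_of_type_algebra\<^esub> (x :: 'a :: field) = - x"
proof -
  interpret R: field "ring_of_type_algebra :: 'a ring" ..
  have "x + \<ominus>\<^bsub>ring_of_type_algebra\<^esub> x = 0"
    using R.r_neg[of x] by simp
  then show ?thesis
    by (simp add: eq_neg_iff_add_eq_0 add.commute)
qed

lemma m_inv_ring_of_type_algebra [simp]:
  assumes "(x :: 'a :: field) \<noteq> 0"
  shows "inv\<^bsub>ring_of_type_algebra\<^esub> x = inverse x"
proof -
  interpret R: field "ring_of_type_algebra :: 'a ring" ..
  have "x \<in> Units ring_of_type_algebra"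
    using R.field_Units assms by simp
  then have "x * inv\<^bsub>ring_of_type_algebra\<^esub> x = 1"
    using R.Units_r_inv[of x] by simp
  then show ?thesis
    by (simp add: inverse_unique)
qed

lemma subfield_closed:
  fixes K :: "'a :: field set"
  assumes "subfield K ring_of_type_algebra"
  shows "0 \<in> K" "1 \<in> K" "x \<in> K \<Longrightarrow> y \<in> K \<Longrightarrow> x + y \<in> K" "x \<in> K \<Longrightarrow> y \<in> K \<Longrightarrow> x * y \<in> K"
    "x \<in> K \<Longrightarrow> - x \<in> K" "x \<in> K \<Longrightarrow> y \<in> K \<Longrightarrow> x - y \<in> K"
    "x \<in> K \<Longrightarrow> inverse x \<in> K" "x \<in> K \<Longrightarrow> y \<in> K \<Longrightarrow> x / y \<in> K"
    "x \<in> K \<Longrightarrow> x ^ n \<in> K" "numeral m \<in> K"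
proof -
  interpret R: field "ring_of_type_algebra :: 'a ring" ..
  note S = subringE[OF subfieldE(1)[OF assms]]
  show zero: "0 \<in> K" and one: "1 \<in> K"
    using S(2,3) by simp_all
  show add: "x + y \<in> K" if "x \<in> K" "y \<in> K" for x y
    using S(7)[OF that] by simp
  show mult: "x * y \<in> K" if "x \<in> K" "y \<in> K" for x y
    using S(6)[OF that] by simp
  show minus: "- x \<in> K" if "x \<in> K" for x
    using S(5)[OF that] by simp
  show "x - y \<in> K" if "x \<in> K" "y \<in> K" for x y
    using add[OF that(1) minus[OF that(2)]] by simp
  show inv: "inverse x \<in> K" if "x \<in> K" for x
    using R.subfield_m_inv(1)[OF assms, of x] that zero by (cases "x = 0") simp_all
  show "x / y \<in> K" if "x \<in> K" "y \<in> K" for x y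
    using mult[OF that(1) inv[OF that(2)]] by (simp add: divide_inverse)
  show "x ^ n \<in> K" if "x \<in> K" for x n
    by (induction n) (simp_all add: one mult that)
  have "of_nat n \<in> K" for n
    by (induction n) (simp_all add: zero one add)
  then show "numeral m \<in> K"
    by (metis of_nat_numeral)
qed

lemma eval_eq_poly:
  fixes x :: "'a :: field"
  shows "ring.eval ring_of_type_algebra l x = poly (Poly (rev l)) x"
proof -
  interpret R: field "ring_of_type_algebra :: 'a ring" ..
  show ?thesis
    by (induction l) (simp_all add: Poly_append poly_monom)
qed

text \<open>
  The minimal polynomial of \<open>\<alpha>\<close> divides \<open>m\<close>, and it cannot have smaller degree than \<open>m\<close>. So the
  dimension can be read off from \<open>m\<close> without proving \<open>m\<close> irreducible.
\<close>

lemma simple_extension_degree: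
  fixes \<alpha> :: "'a :: field"
  assumes K: "subfield K ring_of_type_algebra"
    and m: "m \<noteq> 0" "\<And>i. poly.coeff m i \<in> K" "poly m \<alpha> = 0"
    and least: "\<And>c. (\<And>i. poly.coeff c i \<in> K) \<Longrightarrow> Polynomial.degree c < Polynomial.degree m \<Longrightarrow>
      poly c \<alpha> = 0 \<Longrightarrow> c = 0"
  shows "subfield (ring.simple_extension ring_of_type_algebra K \<alpha>) ring_of_type_algebra"
    and "ring.dimension ring_of_type_algebra (Polynomial.degree m) K
      (ring.simple_extension ring_of_type_algebra K \<alpha>)"
proof -
  interpret R: field "ring_of_type_algebra :: 'a ring" ..
  let ?R = "ring_of_type_algebra :: 'a ring"
  define l where "l = rev (coeffs m)"
  have set_l: "set l \<subseteq> K"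
    using m(2) by (auto simp: l_def coeffs_def split: if_splits)
  have "hd l \<noteq> 0"
    using m(1) by (simp add: l_def hd_rev last_coeffs_eq_coeff_degree)
  then have l: "l \<in> carrier (univ_poly ?R K)" "l \<noteq> []"
    using set_l m(1) by (auto simp: univ_poly_def polynomial_def l_def)
  have l0: "R.eval l \<alpha> = \<zero>\<^bsub>?R\<^esub>"
    using m(3) by (simp add: eval_eq_poly l_def)
  have alg: "(R.algebraic over K) \<alpha>"
    by (rule R.algebraicI[OF l l0])
  show "subfield (R.simple_extension K \<alpha>) ?R"
    using R.simple_extension_is_subfield[OF K, of \<alpha>] alg by simp
  define I where "I = R.Irr K \<alpha>"
  have I: "I \<in> carrier (univ_poly ?R K)" "hd I = 1" "R.eval I \<alpha> = 0" "I pdivides\<^bsub>?R\<^esub> l"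
    using R.IrrE[OF K _ alg] R.Irr_minimal[OF K _ alg l(1) l0] by (auto simp: I_def)
  have "I \<noteq> []"
  proof
    assume "I = []"
    then show False
      using R.IrrE(2)[OF K _ alg] R.pirreducibleE(1)[OF subfieldE(1)[OF K] I(1)] by (simp add: I_def)
  qed
  have "length I - 1 \<le> length l - 1"
    using R.pdivides_imp_degree_le[OF subfieldE(1)[OF K] I(1) l I(4)] .
  then have "length I - 1 \<le> Polynomial.degree m"
    using m(1) by (simp add: l_def length_coeffs_degree)
  moreover have "\<not> length I - 1 < Polynomial.degree m"
  proof
    assume less: "length I - 1 < Polynomial.degree m"
    define c where "c = Poly (rev I)"
    have coeff_c: "poly.coeff c i = nth_default 0 (rev I) i" for i
      by (simp add: c_def)
    have "c = 0"
    proof (rule least)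
      show "poly.coeff c i \<in> K" for i
        using I(1) subfield_closed(1)[OF K]
        by (auto simp: coeff_c univ_poly_def polynomial_def nth_default_def)
           (metis length_rev nth_mem set_rev subsetD)
      have "Polynomial.degree c \<le> length I - 1"
        by (rule degree_le) (auto simp: coeff_c nth_default_def)
      then show "Polynomial.degree c < Polynomial.degree m"
        using less by simp
      show "poly c \<alpha> = 0"
        using I(3) by (simp add: c_def eval_eq_poly)
    qed
    moreover have "poly.coeff c (length I - 1) = 1"
      using \<open>I \<noteq> []\<close> I(2) by (simp add: coeff_c nth_default_def rev_nth hd_conv_nth)
    ultimately show False by simp
  qed
  ultimately have "length I - 1 = Polynomial.degree m"
    by simp
  then show "R.dimension (Polynomial.degree m) K (R.simple_extension K \<alpha>)"
    using R.dimension_simple_extension[OF K _ alg] by (simp add: I_def)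
qed

section \<open>Rational functions of one variable\<close>

text \<open>
  Clearing denominators in \<open>W(N / D)\<close>.
\<close>

lemma poly_homogenize:
  fixes N D W :: "'a :: field poly"
  assumes "\<And>j. j \<ge> m \<Longrightarrow> poly.coeff W j = 0"
  obtains G where "\<And>s. poly D s \<noteq> 0 \<Longrightarrow> poly G s = poly D s ^ m * poly W (poly N s / poly D s)"
proof
  let ?G = "\<Sum>j<m. smult (poly.coeff W j) (N ^ j * D ^ (m - j))"
  fix s assume D: "poly D s \<noteq> 0"
  have "poly W x = (\<Sum>j<m. poly.coeff W j * x ^ j)" for x
  proof (cases "W = 0")
    case False
    then have "Polynomial.degree W < m"
      using assms leading_coeff_0_iff not_le by blast
    then show ?thesis
      by (subst poly_altdef, intro sum.mono_neutral_left) (auto simp: coeff_eq_0)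
  qed simp
  then show "poly ?G s = poly D s ^ m * poly W (poly N s / poly D s)"
    using D by (auto simp: poly_sum sum_distrib_left power_divide power_diff intro!: sum.cong)
qed

text \<open>
  The powers \<open>1, s, \<dots>, s\<^sup>n\<^sup>-\<^sup>1\<close> with \<open>n \<le> deg N\<close> are linearly independent over the polynomials in
  \<open>N / D\<close>. Clearing denominators in a relation yields \<open>C D\<^sup>m + N G = 0\<close>, where \<open>C\<close> is formed from
  the constant terms of the coefficients and has degree less than \<open>deg N\<close>. As \<open>N\<close> and \<open>D\<close> are
  coprime, \<open>N\<close> divides \<open>C\<close>, so \<open>C = 0\<close>; then a factor \<open>N / D\<close> cancels, and the degree of the
  coefficients drops.
\<close>

lemma powers_independent_over_rational_function:
  fixes N D :: "'a :: {field_gcd, field_char_0} poly" and V :: "nat \<Rightarrow> 'a poly"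
  assumes coprime: "coprime N D" and D: "D \<noteq> 0" and n: "n \<le> Polynomial.degree N"
    and "finite B"
    and "\<And>s. s \<notin> B \<Longrightarrow> (\<Sum>i<n. poly (V i) (poly N s / poly D s) * s ^ i) = 0"
    and "i < n"
  shows "V i = 0"
proof -
  have N: "N \<noteq> 0"
    using n \<open>i < n\<close> by auto
  have "\<forall>i<n. V i = 0" if "\<And>i j. i < n \<Longrightarrow> j \<ge> m \<Longrightarrow> poly.coeff (V i) j = 0"
    and "\<And>s. s \<notin> B \<Longrightarrow> (\<Sum>i<n. poly (V i) (poly N s / poly D s) * s ^ i) = 0" and "finite B"
    for m V B
    using that
  proof (induction m arbitrary: V B)
    case 0
    then show ?case by (simp add: poly_eq_iff)
  next
    case (Suc m)
    define v where "v i = poly.coeff (V i) 0" for i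
    define W where "W i = poly_shift 1 (V i)" for i
    have V: "V i = pCons (v i) (W i)" for i
      by (intro poly_eqI) (simp add: v_def W_def coeff_pCons coeff_poly_shift split: nat.split)
    have W: "poly.coeff (W i) j = 0" if "i < n" "j \<ge> m" for i j
      using Suc.prems(1)[OF that(1), of "Suc j"] that(2) by (simp add: W_def coeff_poly_shift)
    then have "\<exists>G. \<forall>s. poly D s \<noteq> 0 \<longrightarrow> poly G s = poly D s ^ m * poly (W i) (poly N s / poly D s)"
      if "i < n" for i
      using that poly_homogenize[of m "W i" D N] by metis
    then obtain G where G: "\<And>i s. i < n \<Longrightarrow> poly D s \<noteq> 0 \<Longrightarrow>
        poly (G i) s = poly D s ^ m * poly (W i) (poly N s / poly D s)"
      by metis
    define C where "C = (\<Sum>i<n. monom (v i) i)"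
    have split: "poly C s + poly N s / poly D s *
        (\<Sum>i<n. poly (W i) (poly N s / poly D s) * s ^ i) = 0" if "s \<notin> B" for s
      using Suc.prems(2)[OF that]
      by (simp add: V C_def poly_sum poly_monom sum.distrib sum_distrib_left algebra_simps)
    have "C * D ^ Suc m + N * (\<Sum>i<n. G i * monom 1 i) = 0"
    proof (rule poly_0_if_cofinitely_many_roots[of "B \<union> {s. poly D s = 0}"])
      show "finite (B \<union> {s. poly D s = 0})"
        using Suc.prems(3) D poly_roots_finite by blast
      fix s assume s: "s \<notin> B \<union> {s. poly D s = 0}"
      have "poly (\<Sum>i<n. G i * monom 1 i) s =
          poly D s ^ m * (\<Sum>i<n. poly (W i) (poly N s / poly D s) * s ^ i)"
        using s by (simp add: poly_sum poly_monom sum_distrib_left G mult_ac)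
      moreover have "poly C s = - (poly N s / poly D s *
          (\<Sum>i<n. poly (W i) (poly N s / poly D s) * s ^ i))"
        using split[of s] s by (simp add: add_eq_0_iff2)
      ultimately show "poly (C * D ^ Suc m + N * (\<Sum>i<n. G i * monom 1 i)) s = 0"
        using s by simp
    qed
    then have "N dvd C * D ^ Suc m"
      by (metis add_eq_0_iff2 dvd_minus_iff dvd_triv_left)
    moreover have "coprime N (D ^ Suc m)"
      using coprime by simp
    ultimately have "N dvd C"
      using coprime_dvd_mult_left_iff by blast
    have coeff_C: "poly.coeff C i = (if i < n then v i else 0)" for i
      by (simp add: C_def coeff_sum if_distrib cong: if_cong)
    have "C = 0"
    proof (rule ccontr)
      assume "C \<noteq> 0"
      then have "poly.coeff C (Polynomial.degree C) \<noteq> 0" by simp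
      then have "Polynomial.degree C < n"
        by (simp add: coeff_C split: if_splits)
      then show False
        using dvd_imp_degree_le[OF \<open>N dvd C\<close> \<open>C \<noteq> 0\<close>] n by simp
    qed
    then have v: "v i = 0" if "i < n" for i
      using coeff_C[of i] that by simp
    have "\<forall>i<n. W i = 0"
    proof (rule Suc.IH[of W "B \<union> {s. poly D s = 0} \<union> {s. poly N s = 0}"])
      show "finite (B \<union> {s. poly D s = 0} \<union> {s. poly N s = 0})"
        using Suc.prems(3) N D poly_roots_finite by blast
      show "(\<Sum>i<n. poly (W i) (poly N s / poly D s) * s ^ i) = 0"
        if "s \<notin> B \<union> {s. poly D s = 0} \<union> {s. poly N s = 0}" for s
        using split[of s] that \<open>C = 0\<close> by simp
    qed (use W in simp)
    then show ?case
      by (simp add: V v)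
  qed
  moreover obtain m where "\<And>i. i < n \<Longrightarrow> Polynomial.degree (V i) < m"
    using finite_nat_set_iff_bounded[of "(\<lambda>i. Polynomial.degree (V i)) ` {..<n}"] by auto
  then have "poly.coeff (V i) j = 0" if "i < n" "j \<ge> m" for i j
    using that by (meson coeff_eq_0 less_le_trans)
  ultimately show ?thesis
    using assms(4,5,6) by blast
qed

text \<open>
  For a sextic \<open>A\<close> this is \<open>q\<^sup>6 A(p / q)\<close>.
\<close>

definition homogenization6 :: "'a :: comm_ring_1 poly \<Rightarrow> 'a poly \<Rightarrow> 'a poly \<Rightarrow> 'a poly"
  where "homogenization6 A p q = (\<Sum>i\<le>6. smult (poly.coeff A i) (p ^ i * q ^ (6 - i)))"

lemma homogenization6_mult:
  "homogenization6 A (g * p) (g * q) = g ^ 6 * homogenization6 A p q"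
proof -
  have "(g * p) ^ i * (g * q) ^ (6 - i) = g ^ 6 * (p ^ i * q ^ (6 - i))" if "i \<le> 6" for i
  proof -
    have "(g * p) ^ i * (g * q) ^ (6 - i) = (g ^ i * g ^ (6 - i)) * (p ^ i * q ^ (6 - i))"
      by (simp add: power_mult_distrib mult_ac)
    then show ?thesis
      using that by (simp flip: power_add)
  qed
  then show ?thesis
    by (simp add: homogenization6_def sum_distrib_left)
qed

lemma dvd_homogenization6_diff:
  "p dvd homogenization6 A p q - smult (poly.coeff A 0) (q ^ 6)"
  "q dvd homogenization6 A p q - smult (poly.coeff A 6) (p ^ 6)"
proof -
  let ?h = "\<lambda>i. smult (poly.coeff A i) (p ^ i * q ^ (6 - i))"
  have "homogenization6 A p q - smult (poly.coeff A 0) (q ^ 6) = sum ?h ({..6} - {0})"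
    by (simp add: homogenization6_def sum.remove[of "{..6}" 0])
  moreover have "p dvd ?h i" if "i \<in> {..6} - {0}" for i
  proof -
    have "p dvd p ^ i"
      using that by (intro dvd_power) auto
    then show ?thesis
      by (simp add: dvd_smult)
  qed
  ultimately show "p dvd homogenization6 A p q - smult (poly.coeff A 0) (q ^ 6)"
    by (simp only: dvd_sum)
  have "homogenization6 A p q - smult (poly.coeff A 6) (p ^ 6) = sum ?h ({..6} - {6})"
    by (simp add: homogenization6_def sum.remove[of "{..6}" 6])
  moreover have "q dvd ?h i" if "i \<in> {..6} - {6}" for i
  proof -
    have "q dvd q ^ (6 - i)"
      using that by (intro dvd_power) auto
    then show ?thesis
      by (simp add: dvd_smult)
  qed
  ultimately show "q dvd homogenization6 A p q - smult (poly.coeff A 6) (p ^ 6)"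
    by (simp only: dvd_sum)
qed

lemma coprime_if_dvd_diff:
  fixes p q r :: "'a :: field_gcd poly"
  assumes "p dvd r - smult c (q ^ n)" "coprime p q" "c \<noteq> 0"
  shows "coprime p r"
proof (rule coprimeI)
  fix d assume "d dvd p" "d dvd r"
  then have "d dvd smult c (q ^ n)"
    using dvd_diff[OF \<open>d dvd r\<close> dvd_trans[OF \<open>d dvd p\<close> assms(1)]] by simp
  then have "d dvd q ^ n"
    using assms(3) by (simp add: dvd_smult_iff)
  then show "is_unit d"
    using \<open>d dvd p\<close> assms(2) by (meson coprime_common_divisor coprime_power_right_iff)
qed

text \<open>
  The equation says that \<open>r = p / q\<close> satisfies \<open>A(r) / r\<^sup>2 = A / X\<^sup>2\<close>. In lowest terms, \<open>p\<close> and \<open>q\<close>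
  are coprime to the homogenization of \<open>A\<close>, because its extreme coefficients do not vanish. So
  \<open>p\<^sup>2 q\<^sup>4\<close> divides \<open>X\<^sup>2\<close>, which forces \<open>q\<close> to be constant and \<open>p\<close> to be a constant multiple of \<open>X\<close>;
  comparison of the coefficients of degree \<open>0\<close> and \<open>5\<close> shows that the two constants agree.
\<close>

lemma rational_reparametrization_trivial:
  fixes A p q :: "'a :: field_gcd poly"
  assumes A: "Polynomial.degree A = 6" "poly.coeff A 0 \<noteq> 0" "poly.coeff A 5 \<noteq> 0"
    and q: "q \<noteq> 0"
    and eq: "A * (p ^ 2 * q ^ 4) = [:0, 1:] ^ 2 * homogenization6 A p q"
  shows "p = [:0, 1:] * q"
proof -
  have A0: "A \<noteq> 0"
    using A(2) by auto
  then have A6: "poly.coeff A 6 \<noteq> 0"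
    by (metis A(1) leading_coeff_0_iff)
  have p: "p \<noteq> 0"
  proof
    assume "p = 0"
    then have "homogenization6 A p q = 0"
      using eq by simp
    with dvd_homogenization6_diff(1)[of p A q] show False
      using \<open>p = 0\<close> A(2) q by simp
  qed
  define g where "g = gcd p q"
  have g: "g \<noteq> 0"
    using p by (simp add: g_def)
  obtain p' q' where pq: "p = g * p'" "q = g * q'" "coprime p' q'"
    using gcd_coprime_exists[of p q] g unfolding g_def by (metis mult.commute)
  define H where "H = homogenization6 A p' q'"
  have "g ^ 6 * (A * (p' ^ 2 * q' ^ 4)) = g ^ 6 * ([:0, 1:] ^ 2 * H)"
    using eq unfolding pq(1,2) homogenization6_mult H_def
    by (simp add: power_mult_distrib algebra_simps eval_nat_numeral)
  then have eq': "A * (p' ^ 2 * q' ^ 4) = [:0, 1:] ^ 2 * H"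
    using g by simp
  have "coprime p' H" "coprime q' H"
    using coprime_if_dvd_diff[OF dvd_homogenization6_diff(1) pq(3) A(2)]
      coprime_if_dvd_diff[OF dvd_homogenization6_diff(2) _ A6] pq(3)
    by (auto simp: H_def coprime_commute)
  then have "coprime (p' ^ 2 * q' ^ 4) H"
    by simp
  moreover have "p' ^ 2 * q' ^ 4 dvd [:0, 1:] ^ 2 * H"
    using eq' by (metis dvd_triv_right)
  ultimately have dvd: "p' ^ 2 * q' ^ 4 dvd [:0, 1:] ^ 2"
    by (simp only: coprime_dvd_mult_left_iff)
  have nz: "p' \<noteq> 0" "q' \<noteq> 0"
    using p q pq by auto
  have "2 * Polynomial.degree p' + 4 * Polynomial.degree q' \<le> 2"
    using dvd_imp_degree_le[OF dvd] nz by (simp add: degree_mult_eq degree_power_eq)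
  then have "Polynomial.degree q' = 0" by simp
  then obtain c where c: "q' = [:c:]" "c \<noteq> 0"
    using nz by (metis degree_eq_zeroE pCons_0_0)
  have "p' ^ 2 dvd [:0, 1:] ^ 2"
    using dvd dvd_mult_left by blast
  then have "p' dvd [:0, 1:]"
    by (simp add: pow_divides_pow_iff)
  then obtain r where r: "[:0, 1:] = p' * r" by blast
  have "Polynomial.degree p' \<noteq> 0"
  proof
    assume "Polynomial.degree p' = 0"
    then obtain d where d: "p' = [:d:]" "d \<noteq> 0"
      using nz by (metis degree_eq_zeroE pCons_0_0)
    have "H = [:poly A (d / c) * c ^ 6:]"
    proof -
      have "H = [:\<Sum>i\<le>6. poly.coeff A i * (d ^ i * c ^ (6 - i)):]"
        by (simp add: H_def homogenization6_def c d poly_const_pow mult_ac flip: sum_to_poly)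
      also have "(\<Sum>i\<le>6. poly.coeff A i * (d ^ i * c ^ (6 - i))) = poly A (d / c) * c ^ 6"
        using c(2) by (simp add: poly_altdef A(1) sum_distrib_left power_divide power_diff mult_ac)
      finally show ?thesis .
    qed
    then have "Polynomial.degree H = 0" by simp
    then have "Polynomial.degree ([:0, 1:] ^ 2 * H) \<le> 2"
      using degree_mult_le[of "[:0, 1:] ^ 2" H] by (simp add: degree_power_eq)
    moreover have "Polynomial.degree (A * (p' ^ 2 * q' ^ 4)) = 6"
      using c d A(1) A0 by (simp add: degree_mult_eq poly_const_pow)
    ultimately show False
      by (simp add: eq')
  qed
  moreover have "p' * r \<noteq> 0"
    unfolding r[symmetric] by simp
  moreover have "Polynomial.degree (p' * r) = 1"
    unfolding r[symmetric] by simp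
  ultimately have "Polynomial.degree r = 0"
    by (auto simp: degree_mult_eq)
  then obtain e where e: "r = [:e:]" "e \<noteq> 0"
    using \<open>p' * r \<noteq> 0\<close> by (metis degree_eq_zeroE mult_zero_right pCons_0_0)
  define d where "d = inverse e"
  have d: "d \<noteq> 0" "p' = [:0, d:]"
  proof -
    have "smult d [:0, 1:] = smult d (smult e p')"
      by (simp add: r e mult.commute)
    then show "p' = [:0, d:]" "d \<noteq> 0"
      using e by (simp_all add: d_def)
  qed
  have "H = (\<Sum>i\<le>6. monom (poly.coeff A i * (d ^ i * c ^ (6 - i))) i)"
  proof -
    have "p' ^ i = monom (d ^ i) i" for i
    proof -
      have "p' = monom d 1"
        by (simp add: d monom_altdef)
      then show ?thesis
        by (simp add: monom_power)
    qed
    then show ?thesis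
      by (simp add: H_def homogenization6_def c poly_const_pow smult_monom mult_ac)
  qed
  then have H: "poly.coeff H i = poly.coeff A i * (d ^ i * c ^ (6 - i))" if "i \<le> 6" for i
    using that by (simp add: coeff_sum)
  have "[:0, 1:] ^ 2 * smult (d ^ 2 * c ^ 4) A = [:0, 1:] ^ 2 * H"
    unfolding eq'[symmetric] using c d by (simp add: poly_const_pow power2_eq_square mult_ac)
  then have "smult (d ^ 2 * c ^ 4) A = H"
    by (subst (asm) mult_cancel_left) simp
  then have *: "d ^ 2 * c ^ 4 * poly.coeff A i = poly.coeff A i * (d ^ i * c ^ (6 - i))" if "i \<le> 6" for i
    using H[OF that] by (metis coeff_smult)
  have "d ^ 2 * c ^ 4 = c ^ 6"
    using *[of 0] A(2) by simp
  then have sq: "d ^ 2 = c ^ 2"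
    using c(2) by (simp add: eval_nat_numeral)
  have "d ^ 2 * c ^ 4 = d ^ 5 * c"
    using *[of 5] A(3) by simp
  then have "d ^ 2 * c * c ^ 3 = d ^ 2 * c * d ^ 3"
    by (simp add: eval_nat_numeral mult_ac)
  then have "c ^ 3 = d ^ 3"
    using c d by simp
  then have "c ^ 2 * c = c ^ 2 * d"
    using sq by (simp add: eval_nat_numeral)
  then have "c = d"
    using c by simp
  then show ?thesis
    by (simp add: pq c d mult.left_commute)
qed

section \<open>Function fields\<close>

lemma to_fract_power [simp]: "to_fract (x ^ n) = to_fract x ^ n"
  by (induction n) simp_all

lemma to_fract_numeral [simp]: "to_fract (numeral n) = numeral n"
proof -
  have "to_fract (of_nat m) = of_nat m" for m
    by (induction m) simp_all
  from this[of "numeral n"] show ?thesis by simp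
qed

lemma subfield_adjoin2: "subfield (adjoin2 k a b) ratfun_field"
  unfolding adjoin2_def
  by (intro field.generate_field_is_subfield field_from_type_algebra) simp

lemmas adjoin2_closed = subfield_closed[OF subfield_adjoin2]

lemma adjoin2_generators:
  "c \<in> k \<Longrightarrow> to_fract (const2 c) \<in> adjoin2 k a b" "to_fract a \<in> adjoin2 k a b" "to_fract b \<in> adjoin2 k a b"
  unfolding adjoin2_def by (auto intro!: generate_field.incl)

lemma adjoin2_least:
  assumes "subfield E ratfun_field" "\<And>c. c \<in> k \<Longrightarrow> to_fract (const2 c) \<in> E" "to_fract a \<in> E" "to_fract b \<in> E"
  shows "adjoin2 k a b \<subseteq> E"
  unfolding adjoin2_def using assms
  by (intro field.generate_field_min_subfield1 field_from_type_algebra) auto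

lemma adjoin2_commute: "adjoin2 k a b = adjoin2 k b a"
  by (simp add: adjoin2_def insert_commute)

lemma adjoin2_elements:
  assumes "z \<in> adjoin2 k a b"
  obtains u v where "subst2 v a b \<noteq> 0" "z = to_fract (subst2 u a b) / to_fract (subst2 v a b)"
proof -
  let ?frac = "\<lambda>z. \<exists>u v. subst2 v a b \<noteq> 0 \<and> z * to_fract (subst2 v a b) = to_fract (subst2 u a b)"
  have "?frac z"
    using assms unfolding adjoin2_def
  proof (induction rule: generate_field.induct)
    case one
    show ?case
      by (intro exI[of _ 1]) simp
  next
    case (incl h)
    then obtain u where "h = to_fract (subst2 u a b)"
      by (auto intro: that[of "const2 _"] that[of varX] that[of varY])
    then show ?case
      by (intro exI[of _ u] exI[of _ 1]) simp
  next
    case (a_inv h)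
    then obtain u v where "subst2 v a b \<noteq> 0" "h * to_fract (subst2 v a b) = to_fract (subst2 u a b)"
      by blast
    then show ?case
      by (intro exI[of _ "- u"] exI[of _ v]) simp
  next
    case (m_inv h)
    then obtain u v where uv: "subst2 v a b \<noteq> 0" "h * to_fract (subst2 v a b) = to_fract (subst2 u a b)"
      by blast
    have h: "h \<noteq> 0"
      using m_inv.hyps by simp
    then have "subst2 u a b \<noteq> 0"
      using uv by auto
    then show ?case
      using h by (intro exI[of _ v] exI[of _ u]) (simp add: uv(2)[symmetric])
  next
    case (eng_add h1 h2)
    then obtain u1 v1 u2 v2 where
      uv: "subst2 v1 a b \<noteq> 0" "h1 * to_fract (subst2 v1 a b) = to_fract (subst2 u1 a b)"
        "subst2 v2 a b \<noteq> 0" "h2 * to_fract (subst2 v2 a b) = to_fract (subst2 u2 a b)"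
      by blast
    show ?case
      using uv(1,3)
      by (intro exI[of _ "u1 * v2 + u2 * v1"] exI[of _ "v1 * v2"])
         (simp add: uv(2,4)[symmetric] algebra_simps)
  next
    case (eng_mult h1 h2)
    then obtain u1 v1 u2 v2 where
      uv: "subst2 v1 a b \<noteq> 0" "h1 * to_fract (subst2 v1 a b) = to_fract (subst2 u1 a b)"
        "subst2 v2 a b \<noteq> 0" "h2 * to_fract (subst2 v2 a b) = to_fract (subst2 u2 a b)"
      by blast
    show ?case
      using uv(1,3)
      by (intro exI[of _ "u1 * u2"] exI[of _ "v1 * v2"])
         (simp add: uv(2,4)[symmetric] algebra_simps)
  qed
  then obtain u v where "subst2 v a b \<noteq> 0" "z * to_fract (subst2 v a b) = to_fract (subst2 u a b)"
    by blast
  then show ?thesis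
    using that by (metis eq_divide_eq to_fract_eq_0_iff)
qed

lemma adjoin2_common_denominator:
  assumes "\<And>i. i < n \<Longrightarrow> c i \<in> adjoin2 k a b"
  obtains v u where "subst2 v a b \<noteq> 0"
    "\<And>i. i < (n :: nat) \<Longrightarrow> c i * to_fract (subst2 v a b) = to_fract (subst2 (u i) a b)"
proof -
  have "\<exists>v u. subst2 v a b \<noteq> 0 \<and> (\<forall>i<n. c i * to_fract (subst2 v a b) = to_fract (subst2 (u i) a b))"
    using assms
  proof (induction n)
    case 0
    show ?case by (intro exI[of _ 1]) simp
  next
    case (Suc n)
    then obtain v u where vu: "subst2 v a b \<noteq> 0"
      "\<And>i. i < n \<Longrightarrow> c i * to_fract (subst2 v a b) = to_fract (subst2 (u i) a b)"
      by (metis less_Suc_eq)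
    obtain u' v' where uv': "subst2 v' a b \<noteq> 0" "c n = to_fract (subst2 u' a b) / to_fract (subst2 v' a b)"
      using adjoin2_elements[of "c n"] Suc.prems by blast
    have "c i * to_fract (subst2 (v * v') a b) =
        to_fract (subst2 (if i = n then u' * v else u i * v') a b)" if "i < Suc n" for i
      using that uv' vu(2)[of i] by (auto simp: less_Suc_eq mult_ac)
    then show ?case
      using vu(1) uv'(1)
      by (intro exI[of _ "v * v'"] exI[of _ "\<lambda>i. if i = n then u' * v else u i * v'"]) simp
  qed
  then show ?thesis
    using that by blast
qed

lemma pinchuk_nz: "pinchuk_t \<noteq> 0" "varX \<noteq> 0"
proof -
  have "eval2 pinchuk_t (0, 0) \<noteq> 0" "eval2 varX (1, 0) \<noteq> 0"
    by (simp_all add: pinchuk_t_def)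
  then show "pinchuk_t \<noteq> 0" "varX \<noteq> 0"
    by (metis eval2_simps(1))+
qed

text \<open>
  The rational formulas for \<open>t\<close>, \<open>x\<close> and \<open>y\<close> in terms of \<open>f\<close> and \<open>P\<close>.
\<close>

lemma variables_in_field_of_P_f:
  assumes E: "subfield E ratfun_field" "to_fract pinchuk_P \<in> E" "to_fract pinchuk_f \<in> E"
  shows "to_fract varX \<in> E" "to_fract varY \<in> E"
proof -
  note closed = subfield_closed[OF E(1)]
  define f h t x y where "f = to_fract pinchuk_f" and "h = to_fract pinchuk_h"
    and "t = to_fract pinchuk_t" and "x = to_fract varX" and "y = to_fract varY"
  note defs = f_def h_def t_def x_def y_def
  have nz: "f \<noteq> 0" "t \<noteq> 0" "x \<noteq> 0"
    by (simp_all add: defs pinchuk_f_nz pinchuk_nz)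
  have "to_fract pinchuk_P = f + h"
    by (simp add: defs pinchuk_P_def)
  then have "h = to_fract pinchuk_P - f" by simp
  then have h: "h \<in> E"
    using E closed by (simp add: f_def)
  have "(h - t) * f = h^2 * (h + 1)"
    using arg_cong[OF pinchuk_f_h_t, of to_fract] by (simp add: defs)
  then have "t = h - h^2 * (h + 1) / f"
    using nz by (simp add: field_simps)
  then have t: "t \<in> E"
    using E h closed by (simp add: f_def)
  have "h - t = x * t^2"
    using arg_cong[OF pinchuk_h_alt, of to_fract] by (simp add: defs)
  then have "x = (h - t) / t^2"
    using nz by simp
  then show x: "to_fract varX \<in> E"
    using h t closed by (simp add: x_def[symmetric])
  have "t = x * y - 1"
    by (simp add: defs pinchuk_t_def)
  then have "y = (t + 1) / x"
    using nz by simp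
  then show "to_fract varY \<in> E"
    using x t closed by (simp add: x_def[symmetric] y_def[symmetric])
qed

lemma pinchuk_in_ratfun:
  "to_fract pinchuk_f \<in> adjoin2 k varX varY" "to_fract pinchuk_P \<in> adjoin2 k varX varY"
  "to_fract pinchuk_V \<in> adjoin2 k varX varY"
  unfolding pinchuk_P_def pinchuk_V_def pinchuk_q_def pinchuk_correction_def pinchuk_f_def pinchuk_h_def pinchuk_t_def
  by (simp_all add: adjoin2_closed adjoin2_generators)

lemma const2_poly_in_subfield:
  assumes "subfield E ratfun_field" "\<And>c. c \<in> k \<Longrightarrow> to_fract (const2 c) \<in> E" "to_fract a \<in> E"
    and "\<And>i. poly.coeff g i \<in> k"
  shows "to_fract (poly (map_poly const2 g) a) \<in> E"
  using assms(4)
proof (induction g)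
  case 0
  then show ?case using subfield_closed[OF assms(1)] by simp
next
  case (pCons c g)
  have "c \<in> k"
    using pCons.prems[of 0] by simp
  moreover have "poly.coeff g i \<in> k" for i
    using pCons.prems[of "Suc i"] by simp
  ultimately show ?case
    using pCons.IH assms(2,3) subfield_closed[OF assms(1)] by (simp add: map_poly_pCons)
qed

text \<open>
  At \<open>x = 0\<close> one has \<open>P = y\<close> and \<open>V = 33 + 200 y\<close>, so \<open>g\<close> can be read off from \<open>Q(0, y)\<close>.
\<close>

lemma normal_form_coeffs_in_subfield:
  assumes k: "subfield k real_field" and Q: "has_coeffs_in k Q"
    and eq: "4 * Q = pinchuk_V - poly (map_poly const2 g) pinchuk_P"
  shows "poly.coeff g i \<in> k"
proof -
  note closed = subfield_closed[OF k]
  define Q0 where "Q0 = map_poly (\<lambda>c. poly.coeff c 0) Q"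
  have Q0: "eval2 Q (0, y) = poly Q0 y" for y
    unfolding Q0_def by (induction Q) (simp_all add: eval2_def map_poly_pCons poly_0_coeff_0)
  have "poly g y = poly ([:33, 200:] - smult 4 Q0) y" for y
    using arg_cong[OF eq, of "\<lambda>p. eval2 p (0, y)"]
    by (simp add: eval2_poly_const2 Q0 pinchuk_P_def pinchuk_V_def pinchuk_q_def pinchuk_correction_def
        pinchuk_f_def pinchuk_h_def pinchuk_t_def algebra_simps)
  then have "g = [:33, 200:] - smult 4 Q0"
    by (simp add: poly_eq_poly_eq_iff[symmetric] fun_eq_iff)
  moreover have "poly.coeff [:33, 200:] i \<in> k"
    using closed by (auto simp: coeff_pCons split: nat.split)
  moreover have "poly.coeff Q0 i \<in> k"
    using Q by (simp add: Q0_def coeff_map_poly has_coeffs_in_def)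
  ultimately show ?thesis
    using closed by simp
qed

lemma adjoin2_normal_form:
  assumes k: "subfield k real_field" and Q: "has_coeffs_in k Q"
    and eq: "4 * Q = pinchuk_V - poly (map_poly const2 g) pinchuk_P"
  shows "adjoin2 k pinchuk_P Q = adjoin2 k pinchuk_V pinchuk_P"
proof -
  let ?S = "to_fract (poly (map_poly const2 g) pinchuk_P)"
  have S: "?S \<in> adjoin2 k pinchuk_P b" for b
    using normal_form_coeffs_in_subfield[OF assms]
    by (intro const2_poly_in_subfield[of _ k] subfield_adjoin2 adjoin2_generators)
  have eq': "4 * to_fract Q = to_fract pinchuk_V - ?S"
    using arg_cong[OF eq, of to_fract] by simp
  have "(4 :: real poly poly fract) \<noteq> 0"
    using to_fract_eq_0_iff[of "4 :: real poly poly"] by simp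
  then have "to_fract Q = (to_fract pinchuk_V - ?S) / 4"
    using eq' by (metis nonzero_mult_div_cancel_left)
  moreover have "(to_fract pinchuk_V - ?S) / 4 \<in> adjoin2 k pinchuk_P pinchuk_V"
    by (intro adjoin2_closed adjoin2_generators S)
  ultimately have "to_fract Q \<in> adjoin2 k pinchuk_P pinchuk_V"
    by (simp only:)
  moreover have "4 * to_fract Q + ?S \<in> adjoin2 k pinchuk_P Q"
    by (intro adjoin2_closed adjoin2_generators S)
  then have "to_fract pinchuk_V \<in> adjoin2 k pinchuk_P Q"
    by (simp add: eq')
  ultimately have "adjoin2 k pinchuk_P Q = adjoin2 k pinchuk_P pinchuk_V"
    by (intro equalityI adjoin2_least subfield_adjoin2 adjoin2_generators)
  then show ?thesis
    by (simp only: adjoin2_commute)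
qed

section \<open>The degree of the extension\<close>

lemma map_poly_sextic:
  fixes \<phi> :: "'a :: comm_ring_1 \<Rightarrow> 'b :: comm_ring_1"
  assumes hom: "\<phi> 0 = 0" "\<phi> 1 = 1" "\<And>x y. \<phi> (x + y) = \<phi> x + \<phi> y" "\<And>x y. \<phi> (x * y) = \<phi> x * \<phi> y"
    "\<And>x. \<phi> (- x) = - \<phi> x"
  shows "map_poly \<phi> (sextic a) = sextic (\<phi> a)"
proof -
  have nat: "\<phi> (of_nat n) = of_nat n" for n
    by (induction n) (simp_all add: hom)
  have num: "\<phi> (numeral n) = numeral n" for n
    using nat[of "numeral n"] by simp
  have pow: "\<phi> (x ^ n) = \<phi> x ^ n" for x n
    by (induction n) (simp_all add: hom)
  have diff: "\<phi> (x - y) = \<phi> x - \<phi> y" for x y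
    using hom(3)[of x "- y"] hom(5) by simp
  show ?thesis
    by (simp add: sextic_def map_poly_pCons hom num pow diff)
qed

lemma coeff_sextic_to_fract: "poly.coeff (sextic (to_fract a)) i = to_fract (poly.coeff (sextic a) i)"
  using map_poly_sextic[of to_fract a] by (simp add: coeff_map_poly flip: map_poly_sextic)

lemma coeff_sextic_eval2: "poly.coeff (sextic (eval2 p w)) i = eval2 (poly.coeff (sextic p) i) w"
  using map_poly_sextic[of "\<lambda>p. eval2 p w" p] by (metis coeff_map_poly eval2_simps)

lemma coeff_sextic_in_subfield:
  fixes E :: "'a :: field set"
  assumes "subfield E ring_of_type_algebra" "a \<in> E"
  shows "poly.coeff (sextic a) i \<in> E"
  using assms(2) subfield_closed[OF assms(1)]
  by (auto simp: sextic_def coeff_pCons split: nat.split)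

lemma degree_sextic:
  assumes "(197 :: 'a :: comm_ring_1) \<noteq> 0"
  shows "Polynomial.degree (sextic (a :: 'a)) = 6"
  using assms by (simp add: sextic_def)

lemma coprime_sextic_square:
  assumes "a \<noteq> 0" "a \<noteq> (-1 :: real)"
  shows "coprime (sextic a) ([:0, 1:] ^ 2)"
proof -
  have "prime_elem ([:0, 1:] :: real poly)"
    by (rule prime_elem_linear_field_poly) simp
  moreover have "\<not> [:0, 1:] dvd sextic a"
    using assms poly_eq_0_iff_dvd[of "sextic a" 0] by (simp add: sextic_0)
  ultimately have "coprime [:0, 1:] (sextic a)"
    by (rule prime_elem_imp_coprime)
  then show ?thesis
    by (simp add: coprime_commute)
qed

text \<open>
  The minimal polynomial of \<open>f\<close> over \<open>k(P, V)\<close>, up to the factor \<open>197\<close>.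
\<close>

definition minpoly_f :: "real poly poly fract poly"
  where "minpoly_f = sextic (to_fract pinchuk_P) - monom (to_fract pinchuk_V) 2"

lemma numeral_ratfun_nz: "(numeral n :: real poly poly fract) \<noteq> 0"
  using to_fract_eq_0_iff[of "numeral n :: real poly poly"] by simp

lemma degree_minpoly_f: "Polynomial.degree minpoly_f = 6"
proof -
  have "Polynomial.degree (monom (to_fract pinchuk_V) 2) < Polynomial.degree (sextic (to_fract pinchuk_P))"
    using degree_monom_le[of "to_fract pinchuk_V" 2] by (simp add: degree_sextic numeral_ratfun_nz)
  then have "Polynomial.degree (sextic (to_fract pinchuk_P) + - monom (to_fract pinchuk_V) 2) = 6"
    by (subst degree_add_eq_left) (simp_all add: degree_sextic numeral_ratfun_nz)
  then show ?thesis
    by (simp add: minpoly_f_def)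
qed

lemma poly_minpoly_f:
  "poly minpoly_f z = (\<Sum>i\<le>6. to_fract (poly.coeff (sextic pinchuk_P) i) * z ^ i) - to_fract pinchuk_V * z ^ 2"
  by (simp add: minpoly_f_def poly_monom poly_altdef[of "sextic _"] degree_sextic numeral_ratfun_nz
      coeff_sextic_to_fract)

lemma poly_minpoly_f_f: "poly minpoly_f (to_fract pinchuk_f) = 0"
proof -
  have "(\<Sum>i\<le>6. poly.coeff (sextic pinchuk_P) i * pinchuk_f ^ i) = pinchuk_V * pinchuk_f ^ 2"
    by (subst sextic_pinchuk[symmetric]) (simp add: poly_altdef degree_sextic)
  from arg_cong[OF this, of to_fract] show ?thesis
    by (simp add: poly_minpoly_f)
qed

lemma infinite_real_Compl: "finite B \<Longrightarrow> infinite (- B :: real set)"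
  using infinite_UNIV_char_0[where 'a = real] by (metis Compl_partition2 finite_Un)

text \<open>
  After multiplication by a common denominator, a polynomial relation of degree less than \<open>6\<close> for \<open>f\<close>
  has coefficients in \<open>\<real>[V, P]\<close>. Restricted to the real points with \<open>P = a\<close> it is a relation between
  the powers of \<open>s\<close> over the polynomials in \<open>sextic a / s\<^sup>2\<close>, hence trivial.
\<close>

lemma minpoly_f_least:
  assumes c: "\<And>i. poly.coeff c i \<in> adjoin2 k pinchuk_V pinchuk_P"
    and deg: "Polynomial.degree c < 6" and root: "poly c (to_fract pinchuk_f) = 0"
  shows "c = 0"
proof -
  obtain v u where v: "subst2 v pinchuk_V pinchuk_P \<noteq> 0" and
    u: "\<And>i. i < 6 \<Longrightarrow> poly.coeff c i * to_fract (subst2 v pinchuk_V pinchuk_P) =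
      to_fract (subst2 (u i) pinchuk_V pinchuk_P)"
    using adjoin2_common_denominator[of 6 "poly.coeff c"] c by blast
  have "poly c z = (\<Sum>i<6. poly.coeff c i * z ^ i)" for z
    unfolding poly_altdef using deg by (intro sum.mono_neutral_left) (auto simp: coeff_eq_0)
  then have "0 = (\<Sum>i<6. poly.coeff c i * to_fract pinchuk_f ^ i) * to_fract (subst2 v pinchuk_V pinchuk_P)"
    using root by simp
  also have "\<dots> = (\<Sum>i<6. (poly.coeff c i * to_fract (subst2 v pinchuk_V pinchuk_P)) * to_fract pinchuk_f ^ i)"
    by (simp add: sum_distrib_left sum_distrib_right mult_ac)
  also have "\<dots> = to_fract (\<Sum>i<6. subst2 (u i) pinchuk_V pinchuk_P * pinchuk_f ^ i)"
    by (simp add: u)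
  finally have rel: "(\<Sum>i<6. subst2 (u i) pinchuk_V pinchuk_P * pinchuk_f ^ i) = 0"
    by (metis to_fract_eq_0_iff)
  have "u i = 0" if "i < 6" for i
  proof (rule poly_poly_0_if_infinitely_many_roots)
    show "infinite (- {0, -1 :: real})"
      by (rule infinite_real_Compl) simp
    fix a :: real assume a: "a \<in> - {0, -1}"
    show "poly (u i) [:a:] = 0"
    proof (rule powers_independent_over_rational_function)
      show "coprime (sextic a) ([:0, 1:] ^ 2)"
        using a by (intro coprime_sextic_square) auto
      show "finite (exceptional a)"
        by (rule finite_exceptional)
      show "(\<Sum>i<6. poly (poly (u i) [:a:]) (poly (sextic a) s / poly ([:0, 1:] ^ 2) s) * s ^ i) = 0"
        if s: "s \<notin> exceptional a" for s
      proof -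
        obtain w where w: "eval2 pinchuk_f w = s" "eval2 pinchuk_P w = a"
          "eval2 pinchuk_V w = poly (sextic a) s / s^2"
          using s by (rule pinchuk_point)
        show ?thesis
          using arg_cong[OF rel, of "\<lambda>p. eval2 p w"]
          by (simp add: eval2_sum eval2_subst2 w) (simp add: eval2_def)
      qed
    qed (use that in \<open>simp_all add: degree_sextic\<close>)
  qed
  then have "poly.coeff c i = 0" if "i < 6" for i
    using u[OF that] v that by simp
  moreover have "poly.coeff c i = 0" if "i \<ge> 6" for i
    using that deg by (simp add: coeff_eq_0)
  ultimately show "c = 0"
    by (metis leading_coeff_0_iff not_le)
qed

lemma ratfun_simple_extension:
  defines "L \<equiv> \<lambda>k. adjoin2 k pinchuk_V pinchuk_P" and "E \<equiv> \<lambda>k. adjoin2 k varX varY"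
  shows "ring.simple_extension ratfun_field (L k) (to_fract pinchuk_f) = E k"
    and "ring.dimension ratfun_field 6 (L k) (E k)"
proof -
  interpret R: field ratfun_field ..
  let ?S = "R.simple_extension (L k) (to_fract pinchuk_f)"
  have L: "subfield (L k) ratfun_field"
    unfolding L_def by (rule subfield_adjoin2)
  have LE: "L k \<subseteq> E k"
    unfolding L_def E_def by (intro adjoin2_least subfield_adjoin2 adjoin2_generators pinchuk_in_ratfun)
  have "poly.coeff minpoly_f i \<in> L k" for i
    unfolding minpoly_f_def L_def
    by (simp add: adjoin2_closed adjoin2_generators coeff_sextic_in_subfield subfield_adjoin2)
  moreover have "minpoly_f \<noteq> 0"
    using degree_minpoly_f by auto
  ultimately have S: "subfield ?S ratfun_field" "R.dimension 6 (L k) ?S"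
    using simple_extension_degree[OF L, of minpoly_f "to_fract pinchuk_f"] poly_minpoly_f_f
      minpoly_f_least[of _ k] unfolding degree_minpoly_f L_def by auto
  have LS: "L k \<subseteq> ?S" "to_fract pinchuk_f \<in> ?S"
    using R.simple_extension_incl[of "L k"] R.simple_extension_mem[OF subfieldE(1)[OF L]] by auto
  have k_in_S: "to_fract (const2 c) \<in> ?S" if "c \<in> k" for c
    using that LS(1) adjoin2_generators(1) unfolding L_def by blast
  have "to_fract pinchuk_P \<in> ?S"
    using LS(1) adjoin2_generators(3) unfolding L_def by blast
  then have "E k \<subseteq> ?S"
    unfolding E_def using k_in_S variables_in_field_of_P_f[OF S(1) _ LS(2)]
    by (intro adjoin2_least S(1)) auto
  moreover have "?S \<subseteq> E k"
    using R.simple_extension_subring_incl[of "E k" "L k"] subfieldE(1)[OF subfield_adjoin2] LE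
      pinchuk_in_ratfun(1)
    unfolding E_def by blast
  ultimately show "?S = E k"
    by blast
  then show "R.dimension 6 (L k) (E k)"
    using S(2) by simp
qed

section \<open>Automorphisms of the extension\<close>

text \<open>
  Write \<open>r = p / q\<close> with polynomials \<open>p\<close>, \<open>q\<close> in \<open>f\<close> and \<open>P\<close>. Specializing \<open>P\<close> to a real number
  \<open>a\<close>, the root equation becomes the hypothesis of \<open>rational_reparametrization_trivial\<close>. So
  \<open>p = f q\<close> holds on infinitely many lines \<open>P = a\<close> and therefore identically.
\<close>

lemma f_only_root_of_minpoly_f:
  assumes root: "poly minpoly_f r = 0" and r: "r \<in> adjoin2 k varX varY"
  shows "r = to_fract pinchuk_f"
proof -
  have "adjoin2 k varX varY \<subseteq> adjoin2 k pinchuk_f pinchuk_P"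
    by (intro adjoin2_least subfield_adjoin2 adjoin2_generators variables_in_field_of_P_f)
  then obtain p q where q: "subst2 q pinchuk_f pinchuk_P \<noteq> 0"
    and pq: "r = to_fract (subst2 p pinchuk_f pinchuk_P) / to_fract (subst2 q pinchuk_f pinchuk_P)"
    using r adjoin2_elements by blast
  define p' q' where "p' = subst2 p pinchuk_f pinchuk_P" and "q' = subst2 q pinchuk_f pinchuk_P"
  have q0: "q \<noteq> 0"
    using q by auto
  have "(\<Sum>i\<le>6. to_fract (poly.coeff (sextic pinchuk_P) i) * (to_fract p' ^ i * to_fract q' ^ (6 - i))) =
      (\<Sum>i\<le>6. to_fract (poly.coeff (sextic pinchuk_P) i) * r ^ i) * to_fract q' ^ 6"
    unfolding pq p'_def[symmetric] q'_def[symmetric] sum_distrib_right using q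
    by (intro sum.cong refl) (simp add: power_divide power_diff q'_def)
  also have "\<dots> = to_fract pinchuk_V * (to_fract p' ^ 2 * to_fract q' ^ 4)"
    using root q unfolding poly_minpoly_f pq p'_def[symmetric] q'_def[symmetric]
    by (simp add: q'_def power_divide eval_nat_numeral)
  finally have "to_fract (\<Sum>i\<le>6. poly.coeff (sextic pinchuk_P) i * (p' ^ i * q' ^ (6 - i))) =
      to_fract (pinchuk_V * (p' ^ 2 * q' ^ 4))"
    by simp
  then have rel: "(\<Sum>i\<le>6. poly.coeff (sextic pinchuk_P) i * (p' ^ i * q' ^ (6 - i))) =
      pinchuk_V * (p' ^ 2 * q' ^ 4)"
    by (simp only: to_fract_eq_iff)
  \<comment> \<open>\<open>0\<close> and \<open>-1\<close> are the zeros of the constant coefficient of \<open>sextic a\<close>, and \<open>-52/57\<close> is the zero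
    of its coefficient of degree \<open>5\<close>.\<close>
  define B where "B = {0, -1, - 52 / 57} \<union> {a. poly q [:a:] = 0}"
  have "finite B"
    using poly_poly_0_if_infinitely_many_roots[of _ q] q0 by (auto simp: B_def)
  have "p - varX * q = 0"
  proof (rule poly_poly_0_if_infinitely_many_roots)
    show "infinite (- B)"
      using \<open>finite B\<close> by (rule infinite_real_Compl)
    fix a assume a: "a \<in> - B"
    define pa qa where "pa = poly p [:a:]" and "qa = poly q [:a:]"
    have "sextic a * (pa ^ 2 * qa ^ 4) - [:0, 1:] ^ 2 * homogenization6 (sextic a) pa qa = 0"
    proof (rule poly_0_if_cofinitely_many_roots[OF finite_exceptional])
      fix s assume s: "s \<notin> exceptional a"
      then obtain w where w: "eval2 pinchuk_f w = s" "eval2 pinchuk_P w = a"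
          "eval2 pinchuk_V w = poly (sextic a) s / s^2"
        by (rule pinchuk_point)
      have "s \<noteq> 0"
        using s by (simp add: exceptional_def)
      moreover have "eval2 p' w = poly pa s" "eval2 q' w = poly qa s"
        by (simp_all add: p'_def q'_def eval2_subst2 w) (simp_all add: eval2_def pa_def qa_def)
      then have "(\<Sum>i\<le>6. poly.coeff (sextic a) i * (poly pa s ^ i * poly qa s ^ (6 - i))) =
          poly (sextic a) s / s^2 * (poly pa s ^ 2 * poly qa s ^ 4)"
        using arg_cong[OF rel, of "\<lambda>p. eval2 p w"]
        by (simp add: eval2_sum w flip: coeff_sextic_eval2)
      ultimately show "poly (sextic a * (pa ^ 2 * qa ^ 4) - [:0, 1:] ^ 2 * homogenization6 (sextic a) pa qa) s = 0"
        by (simp add: homogenization6_def poly_sum)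
    qed
    then have "pa = [:0, 1:] * qa"
      using a by (intro rational_reparametrization_trivial[of "sextic a"])
        (auto simp: degree_sextic B_def qa_def sextic_def numeral_eq_Suc)
    then show "poly (p - varX * q) [:a:] = 0"
      by (simp add: pa_def qa_def varX_def)
  qed
  then have "p = varX * q" by simp
  then show ?thesis
    using q pq by simp
qed

lemma automorphism_trivial:
  assumes \<sigma>: "\<sigma> \<in> relative_automorphisms ratfun_field (adjoin2 k pinchuk_V pinchuk_P) (adjoin2 k varX varY)"
    and z: "z \<in> adjoin2 k varX varY"
  shows "\<sigma> z = z"
proof -
  interpret R: field ratfun_field ..
  let ?L = "adjoin2 k pinchuk_V pinchuk_P" and ?E = "adjoin2 k varX varY"
  have LE: "?L \<subseteq> ?E"
    by (intro adjoin2_least subfield_adjoin2 adjoin2_generators pinchuk_in_ratfun)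
  have hom: "\<sigma> \<in> ring_hom (ratfun_field\<lparr>carrier := ?E\<rparr>) (ratfun_field\<lparr>carrier := ?E\<rparr>)"
    and fix_L: "\<And>a. a \<in> ?L \<Longrightarrow> \<sigma> a = a"
    using \<sigma> by (auto simp: relative_automorphisms_def ring_iso_def)
  have \<sigma>: "\<sigma> x \<in> ?E" "\<sigma> (x + y) = \<sigma> x + \<sigma> y" "\<sigma> (x * y) = \<sigma> x * \<sigma> y" if "x \<in> ?E" "y \<in> ?E" for x y
    using ring_hom_closed[OF hom, of x] ring_hom_add[OF hom, of x y] ring_hom_mult[OF hom, of x y] that
    by simp_all
  let ?f = "to_fract pinchuk_f"
  have f: "?f \<in> ?E"
    by (rule pinchuk_in_ratfun)
  have \<sigma>_poly: "\<sigma> (poly c ?f) = poly c (\<sigma> ?f) \<and> poly c ?f \<in> ?E" if "\<And>i. poly.coeff c i \<in> ?L" for c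
    using that
  proof (induction c)
    case 0
    then show ?case
      using fix_L[of 0] by (simp add: adjoin2_closed)
  next
    case (pCons a c)
    have a: "a \<in> ?L"
      using pCons.prems[of 0] by simp
    have "poly.coeff c i \<in> ?L" for i
      using pCons.prems[of "Suc i"] by simp
    then have c: "\<sigma> (poly c ?f) = poly c (\<sigma> ?f)" "poly c ?f \<in> ?E"
      using pCons.IH by auto
    have "a \<in> ?E" "?f * poly c ?f \<in> ?E"
      using a LE f c(2) adjoin2_closed by auto
    then show ?case
      using c f \<sigma> fix_L[OF a] adjoin2_closed(3) by simp
  qed
  have "poly.coeff minpoly_f i \<in> ?L" for i
    unfolding minpoly_f_def
    by (simp add: adjoin2_closed adjoin2_generators coeff_sextic_in_subfield subfield_adjoin2)
  then have "poly minpoly_f (\<sigma> ?f) = 0"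
    using \<sigma>_poly[of minpoly_f] fix_L[of 0] by (simp add: poly_minpoly_f_f adjoin2_closed)
  then have \<sigma>f: "\<sigma> ?f = ?f"
    using \<sigma>(1)[OF f f] by (rule f_only_root_of_minpoly_f)
  have "z \<in> R.simple_extension ?L ?f"
    using z ratfun_simple_extension(1)[of k] by simp
  then have "\<sigma> z = z \<and> z \<in> ?E"
  proof (induction rule: R.simple_extension.induct)
    case zero
    then show ?case
      using fix_L[of 0] by (simp add: adjoin2_closed)
  next
    case (lin k1 k2)
    then have "k1 * ?f \<in> ?E" "k2 \<in> ?E"
      using f LE adjoin2_closed by auto
    then show ?case
      using lin \<sigma> f \<sigma>f fix_L adjoin2_closed(3) by simp
  qed
  then show ?thesis by blast
qed

section \<open>Pinchuk maps have degree six and are generically two to one\<close>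

theorem theorem1:
  fixes P Q :: "real poly poly" and k :: "real set"
  assumes "pinchuk_map P Q"
    and "subfield k real_field"
    and "has_coeffs_in k P" and "has_coeffs_in k Q"
  shows "generically_two_to_one (polynomial_map P Q) \<and>
    ring.dimension ratfun_field 6 (adjoin2 k P Q) (adjoin2 k varX varY) \<and>
    (\<forall>\<sigma> \<in> relative_automorphisms ratfun_field (adjoin2 k P Q) (adjoin2 k varX varY).
       \<forall>a \<in> adjoin2 k varX varY. \<sigma> a = a)"
proof -
  obtain g where P: "P = pinchuk_P"
    and Q: "4 * Q = pinchuk_V - poly (map_poly const2 g) pinchuk_P"
    using assms(1) by (rule pinchuk_map_normal_form)
  have "adjoin2 k P Q = adjoin2 k pinchuk_V pinchuk_P"
    unfolding P using assms(2,4) Q by (rule adjoin2_normal_form)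
  then show ?thesis
    using generically_two_to_one_if_normal_form[OF Q] ratfun_simple_extension(2) automorphism_trivial
    by (simp add: P)
qed

end
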